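(* For an integer $N\ge 3$ put $\alpha_j=2\pi j/N$, $j=1,\dots,N$, and let $\xi_1,\dots,\xi_N$ be independent random variables, each uniformly distributed on $[0,1]$ (the lengths of the teeth of the random circular comb). For pairwise distinct $n_1,n_2,n_3\in\{1,\dots,N\}$ let $\mathsf P_N\{\nu=(n_1,n_2,n_3)\}$ be the probability that the hoop $J$ is supported by the teeth with numbers $n_1,n_2,n_3$. For $\varphi=(\varphi_1,\varphi_2,\varphi_3)\in\mathcal S$ put $$p_{\mathcal S}(\varphi)=\lim_{N\to\infty}\Big(\frac{N}{2\pi}\Big)^3\mathsf P_N\{\nu=(n_1,n_2,n_3)\},$$ where $n_i=n_i(N)$ and $2\pi n_i/N\to\varphi_i \bmod 2\pi$ for $i=1,2,3$, and let $p_{\mathcal T}$ be the induced density on $\widehat{\mathcal T}=\mathcal T/\mathbb Z_3$ with respect to the measure $\mu_{\mathcal T}$, i.e. $p_{\mathcal T}(\vartheta(\varphi))=2\pi\,p_{\mathcal S}(\varphi)$. Then for every $\vartheta=(\vartheta_1,\vartheta_2,\vartheta_3)\in\mathcal T$ $$p_{\mathcal T}(\vartheta)=2\pi\,\sin\frac{\vartheta_1}{2}\,\sin\frac{\vartheta_2}{2}\,\sin\frac{\vartheta_3}{2}\,\Big(\frac1{\pi^2}+\sum_{i=1}^3 f(\vartheta_i)\Big),\qquad f(\xi)=\int_0^{\xi/2}\frac{(\xi-2\varphi)\sin\varphi}{\big((\pi-\varphi)\cos\varphi+\sin\varphi\big)^3}\,d\varphi .$$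
   Context: Random circular comb: at each point $w_j=(\cos\alpha_j,\sin\alpha_j,0)$ of the unit horizontal circle $\{x^2+y^2=1,\ z=0\}\subset\mathbb R^3$ there stands a vertical segment ("tooth") with lower end $w_j$ and upper end $(\cos\alpha_j,\sin\alpha_j,\xi_j)$. A thin rigid hoop $J$, with mass center at its center, lies on the comb; with probability $1$ it is supported by three teeth. "$J$ is supported by the teeth $n_1,n_2,n_3$" means that the plane $z=\ell(x,y)$ ($\ell$ affine) through the upper ends of the teeth $n_1,n_2,n_3$ has all other teeth under it, i.e. $\xi_j\le\ell(\cos\alpha_j,\sin\alpha_j)$ for all $j$, and that the mass center lies over the triangle with vertices $w_{n_1},w_{n_2},w_{n_3}$ (i.e. the origin lies inside this triangle). Let $\mathbb T=\mathbb R/2\pi\mathbb Z$. Subscripts $i\in\{1,2,3\}$ are taken in the cyclic group $\mathbb Z_3$. For a positively oriented triple $\varphi=(\varphi_1,\varphi_2,\varphi_3)\in\mathbb T^3$ the numbers $\vartheta_i=\vartheta_i(\varphi)>0$ are defined by $\varphi_{i+1}-\varphi_i=\vartheta_{i-1}\bmod 2\pi$, $\vartheta_1+\vartheta_2+\vartheta_3=2\pi$. Put $$\mathcal S=\{\varphi\in\mathbb T^3: 0<\vartheta_i(\varphi)<\pi,\ i=1,2,3\},\qquad \mathcal T=\{\vartheta=(\vartheta_1,\vartheta_2,\vartheta_3): 0<\vartheta_i<\pi,\ \vartheta_1+\vartheta_2+\vartheta_3=2\pi\}.$$ Cyclic permutations of $(\varphi_1,\varphi_2,\varphi_3)$ give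 the same support event, so the distribution lives on $\mathcal S/\mathbb Z_3$; it is invariant under the rotations $\varphi\mapsto\varphi+\alpha(1,1,1)$, $\alpha\in\mathbb T$, and the quotient of $\mathcal S/\mathbb Z_3$ by rotations is $\widehat{\mathcal T}=\mathcal T/\mathbb Z_3$ ($\mathbb Z_3$ acting by cyclic permutations). The measure on $\mathcal T$, and on $\widehat{\mathcal T}$, is $d\mu_{\mathcal T}=\frac13|d\vartheta_3\wedge d\vartheta_2+d\vartheta_1\wedge d\vartheta_3+d\vartheta_2\wedge d\vartheta_1|$, which equals $d\vartheta_1\,d\vartheta_2$ in the coordinates $(\vartheta_1,\vartheta_2)$. A function on $\widehat{\mathcal T}$ is written as a $\mathbb Z_3$-invariant function on $\mathcal T$. *)

theory Defs
  imports "HOL-Probability.Probability" "HOL-Library.Real_Mod"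
begin

section \<open>The random circular comb and the support event\<close>

text \<open>
  The cyclic group of indices 1, 2, 3 is the type \<open>3\<close> of integers modulo 3
  (where \<open>3 = 0\<close>), so \<open>i + 1\<close> and \<open>i - 1\<close> below are
  cyclic. A triple of tooth numbers is a function \<open>3 \<Rightarrow> nat\<close>.
\<close>

definition tooth_angle :: "nat \<Rightarrow> nat \<Rightarrow> real" where
  "tooth_angle N j = 2 * pi * real j / real N"

definition tooth_base :: "nat \<Rightarrow> nat \<Rightarrow> real \<times> real" where
  "tooth_base N j = (cos (tooth_angle N j), sin (tooth_angle N j))"

definition affine_height :: "(real \<times> real \<Rightarrow> real) \<Rightarrow> bool" where
  "affine_height l \<longleftrightarrow> (\<exists>a b c. l = (\<lambda>(x, y). a * x + b * y + c))"

text \<open>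
  The first argument \<open>x\<close> gives the tooth lengths. The mass center has to lie
  strictly inside the triangle of tooth bases.
\<close>

definition supported_by :: "(nat \<Rightarrow> real) \<Rightarrow> nat \<Rightarrow> (3 \<Rightarrow> nat) \<Rightarrow> bool" where
  "supported_by x N n \<longleftrightarrow>
     (\<exists>l. affine_height l \<and>
        (\<forall>i. l (tooth_base N (n i)) = x (n i)) \<and>
        (\<forall>j\<in>{1..N}. x j \<le> l (tooth_base N j))) \<and>
     (0, 0) \<in> interior (convex hull (range (\<lambda>i. tooth_base N (n i))))"

text \<open>
  Here \<open>M N\<close> is the probability space carrying the comb with \<open>N\<close>
  teeth, and \<open>X N j\<close> is the random length of its \<open>j\<close>-th tooth.
\<close>

definition random_comb :: "(nat \<Rightarrow> 'a measure) \<Rightarrow> (nat \<Rightarrow> nat \<Rightarrow> 'a \<Rightarrow> real) \<Rightarrow> bool" where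
  "random_comb M X \<longleftrightarrow>
     (\<forall>N\<ge>3. prob_space (M N) \<and>
        prob_space.indep_vars (M N) (\<lambda>_. borel) (X N) {1..N} \<and>
        (\<forall>j\<in>{1..N}. distr (M N) borel (X N j) = uniform_measure lborel {0..1}))"

definition support_prob ::
  "(nat \<Rightarrow> 'a measure) \<Rightarrow> (nat \<Rightarrow> nat \<Rightarrow> 'a \<Rightarrow> real) \<Rightarrow> nat \<Rightarrow> (3 \<Rightarrow> nat) \<Rightarrow> real" where
  "support_prob M X N n =
     measure (M N) {\<omega> \<in> space (M N). supported_by (\<lambda>j. X N j \<omega>) N n}"


section \<open>Triples of angles\<close>

text \<open>
  A point of the torus is given by a real representative of each of its coordinates;
  everything below depends on these only modulo \<open>2 * pi\<close>.
\<close>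

definition arc_gaps :: "real ^ 3 \<Rightarrow> real ^ 3 \<Rightarrow> bool" where
  "arc_gaps \<phi> \<theta> \<longleftrightarrow>
     (\<forall>i. \<theta> $ i > 0) \<and> (\<Sum>i\<in>UNIV. \<theta> $ i) = 2 * pi \<and>
     (\<forall>i. [\<phi> $ (i + 1) - \<phi> $ i = \<theta> $ (i - 1)] (rmod (2 * pi)))"

definition positively_oriented :: "real ^ 3 \<Rightarrow> bool" where
  "positively_oriented \<phi> \<longleftrightarrow> (\<exists>\<theta>. arc_gaps \<phi> \<theta>)"

definition vartheta :: "real ^ 3 \<Rightarrow> real ^ 3" where
  "vartheta \<phi> = (THE \<theta>. arc_gaps \<phi> \<theta>)"

definition S_set :: "(real ^ 3) set" where
  "S_set = {\<phi>. positively_oriented \<phi> \<and> (\<forall>i. 0 < vartheta \<phi> $ i \<and> vartheta \<phi> $ i < pi)}"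

definition T_set :: "(real ^ 3) set" where
  "T_set = {\<theta>. (\<forall>i. 0 < \<theta> $ i \<and> \<theta> $ i < pi) \<and> (\<Sum>i\<in>UNIV. \<theta> $ i) = 2 * pi}"


section \<open>Limit densities\<close>

definition tendsto_mod_2pi :: "(nat \<Rightarrow> real) \<Rightarrow> real \<Rightarrow> bool" where
  "tendsto_mod_2pi a x \<longleftrightarrow> (\<exists>b. b \<longlonglongrightarrow> x \<and> (\<forall>N. [a N = b N] (rmod (2 * pi))))"

definition teeth_tend_to :: "(nat \<Rightarrow> 3 \<Rightarrow> nat) \<Rightarrow> real ^ 3 \<Rightarrow> bool" where
  "teeth_tend_to n \<phi> \<longleftrightarrow>
     (\<forall>\<^sub>F N in sequentially. inj (n N) \<and> range (n N) \<subseteq> {1..N}) \<and>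
     (\<forall>i. tendsto_mod_2pi (\<lambda>N. tooth_angle N (n N i)) (\<phi> $ i))"

definition has_support_limit ::
  "(nat \<Rightarrow> 'a measure) \<Rightarrow> (nat \<Rightarrow> nat \<Rightarrow> 'a \<Rightarrow> real) \<Rightarrow> real ^ 3 \<Rightarrow> real \<Rightarrow> bool" where
  "has_support_limit M X \<phi> p \<longleftrightarrow>
     (\<forall>n. teeth_tend_to n \<phi> \<longrightarrow>
        (\<lambda>N. (real N / (2 * pi)) ^ 3 * support_prob M X N (n N)) \<longlonglongrightarrow> p)"

definition p_S :: "(nat \<Rightarrow> 'a measure) \<Rightarrow> (nat \<Rightarrow> nat \<Rightarrow> 'a \<Rightarrow> real) \<Rightarrow> real ^ 3 \<Rightarrow> real" where
  "p_S M X \<phi> = (THE p. has_support_limit M X \<phi> p)"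

text \<open>
  The density with respect to \<open>d\<theta>\<^sub>1 d\<theta>\<^sub>2\<close> induced on the quotient by
  rotations: a fibre has length \<open>2 * pi\<close>. The value does not depend on the chosen
  point of the fibre when \<open>p_S\<close> is invariant under rotations.
\<close>

definition p_T :: "(nat \<Rightarrow> 'a measure) \<Rightarrow> (nat \<Rightarrow> nat \<Rightarrow> 'a \<Rightarrow> real) \<Rightarrow> real ^ 3 \<Rightarrow> real" where
  "p_T M X \<theta> = 2 * pi * p_S M X (SOME \<phi>. \<phi> \<in> S_set \<and> vartheta \<phi> = \<theta>)"

definition f_arc :: "real \<Rightarrow> real" where
  "f_arc \<xi> = integral {0..\<xi> / 2}
     (\<lambda>\<phi>. (\<xi> - 2 * \<phi>) * sin \<phi> / ((pi - \<phi>) * cos \<phi> + sin \<phi>) ^ 3)"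

end

theory Submission
  imports Defs
begin

text \<open>
  Measure tooth lengths by their depth \<open>1 - \<xi>\<close> below the maximal length. If the three teeth
  under the hoop have depths \<open>y\<^sub>1, y\<^sub>2, y\<^sub>3\<close>, then the depth of the hoop over the unit circle
  is the trigonometric polynomial \<open>g\<close> of degree one that interpolates these three values, and
  every other tooth \<open>j\<close> has to have depth at least \<open>g(\<alpha>\<^sub>j)\<close>. By independence the support
  probability is the integral over the cube \<open>[0,1]\<^sup>3\<close> of the product of the factors
  \<open>1 - g(\<alpha>\<^sub>j)\<close>, truncated to \<open>[0,1]\<close> (\<open>support_prob_eq_integral\<close>,
  in terms of lengths). The relevant depths are of order \<open>1/N\<close>. With \<open>y = (2\<pi>/N) u\<close> the cube yields the factor \<open>(2\<pi>/N)\<^sup>3\<close>, and the product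
  tends to \<open>exp (- G u)\<close>, where \<open>G u\<close> is the integral over the circle of the positive part
  of the polynomial that interpolates \<open>u\<close> (\<open>scaled_support_integrand_tendsto\<close>). The teeth are
  equally spaced, so the sum of \<open>g\<close> over all of them is \<open>N\<close> times its mean. Since the origin
  lies inside the triangle, this mean is a combination of the \<open>u\<^sub>i\<close> with positive weights, which
  gives an integrable exponential majorant (\<open>scaled_support_integrand_le\<close>). Hence the limit
  density is the integral of \<open>exp (- G u)\<close> over the positive octant
  (\<open>scaled_support_prob_tendsto\<close>).

  This integral is computed by writing the interpolating polynomial as
  \<open>\<rho> (q - cos (x - \<psi>))\<close>. The Jacobian of \<open>(q, \<rho>, \<psi>) \<mapsto> u\<close> is \<open>\<rho>\<^sup>2\<close> times twice the area of
  the triangle, which is \<open>4 sin(\<theta>\<^sub>1/2) sin(\<theta>\<^sub>2/2) sin(\<theta>\<^sub>3/2)\<close>. Moreover \<open>G u = \<rho> H(q)\<close>, where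
  \<open>H(q)\<close> is the integral of the positive part of \<open>q - cos x\<close>, so that integrating over \<open>\<rho>\<close>
  leaves \<open>2 / H(q)\<^sup>3\<close>. The condition \<open>u \<ge> 0\<close> restricts \<open>\<psi>\<close>. For \<open>q \<ge> 1\<close> all directions are
  allowed and \<open>H(q) = 2\<pi>q\<close>. This part gives \<open>1/(4\<pi>\<^sup>2)\<close>. For \<open>q = cos \<kappa>\<close> with
  \<open>0 < \<kappa> < \<pi>/2\<close> the polynomial is negative on an arc of half-width \<open>\<kappa>\<close> about \<open>\<psi>\<close>, which must
  fit between two neighbouring supporting teeth. The allowed directions have total length
  \<open>\<Sum>\<^sub>i (\<theta>\<^sub>i - 2\<kappa>)\<^sup>+\<close> and \<open>H(q) = 2((\<pi> - \<kappa>) cos \<kappa> + sin \<kappa>)\<close>. Substituting \<open>q = cos \<kappa>\<close>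
  turns the rest of the integral into \<open>\<Sum>\<^sub>i f(\<theta>\<^sub>i) / 4\<close> (\<open>nn_integral_support_density\<close>).
  For \<open>q < 0\<close> no direction is allowed. The factor \<open>4\<close> in the Jacobian cancels the two quarters.
\<close>

section \<open>Trigonometric interpolation at three points of the circle\<close>

text \<open>
  A hoop in the plane \<open>z = \<ell>(x, y)\<close> has height \<open>c + a cos x + s sin x\<close> at the angle \<open>x\<close>. The
  coefficients below solve, by Cramer's rule, the linear system that prescribes the heights
  \<open>u $ i\<close> at the angles \<open>b $ i\<close>; the determinant is twice the signed area of the triangle with
  vertices at these angles.
\<close>

definition interp_det :: "real ^ 3 \<Rightarrow> real" where
  "interp_det b = (\<Sum>i\<in>UNIV. sin (b $ (i + 2) - b $ (i + 1)))"

definition interp_const :: "real ^ 3 \<Rightarrow> real ^ 3 \<Rightarrow> real" where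
  "interp_const b u = (\<Sum>i\<in>UNIV. u $ i * sin (b $ (i + 2) - b $ (i + 1))) / interp_det b"

definition interp_cos :: "real ^ 3 \<Rightarrow> real ^ 3 \<Rightarrow> real" where
  "interp_cos b u = (\<Sum>i\<in>UNIV. u $ i * (sin (b $ (i + 1)) - sin (b $ (i + 2)))) / interp_det b"

definition interp_sin :: "real ^ 3 \<Rightarrow> real ^ 3 \<Rightarrow> real" where
  "interp_sin b u = (\<Sum>i\<in>UNIV. u $ i * (cos (b $ (i + 2)) - cos (b $ (i + 1)))) / interp_det b"

definition interp :: "real ^ 3 \<Rightarrow> real ^ 3 \<Rightarrow> real \<Rightarrow> real" where
  "interp b u x = interp_const b u + interp_cos b u * cos x + interp_sin b u * sin x"

lemma three_add_simps [simp]: "1 + 2 = (3::3)" "1 + 1 = (2::3)" "2 + 2 = (1::3)" "2 + 1 = (3::3)"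
  "3 + 2 = (2::3)" "3 + 1 = (1::3)" "4 = (1::3)" "5 = (2::3)"
  by simp_all

lemma interp_det_eq: "interp_det b = sin (b$3 - b$2) + sin (b$1 - b$3) + sin (b$2 - b$1)"
  unfolding interp_det_def sum_3 three_add_simps ..

lemma interp_unique:
  assumes D: "interp_det b \<noteq> 0"
    and u: "\<And>i. u $ i = p + q * cos (b $ i) + r * sin (b $ i)"
  shows "interp_const b u = p" "interp_cos b u = q" "interp_sin b u = r"
  using D unfolding interp_const_def interp_cos_def interp_sin_def divide_eq_eq
  by (simp_all add: interp_det_eq sum_3 u sin_diff) algebra+

lemma interp_node:
  assumes D: "interp_det b \<noteq> 0"
  shows "interp b u (b $ i) = u $ i"
proof -
  have "i = 1 \<or> i = 2 \<or> i = 3" using exhaust_3 by blast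
  moreover have "interp_det b * interp b u (b $ k) = interp_det b * u $ k" if "k = 1 \<or> k = 2 \<or> k = 3" for k
    using that D unfolding interp_def interp_const_def interp_cos_def interp_sin_def
    apply (simp add: distrib_left)
    apply (elim disjE)
    apply (simp_all add: interp_det_eq sum_3 sin_diff algebra_simps)
    done
  ultimately show ?thesis using D by auto
qed

text \<open>
  The three angles are real representatives in increasing order within one turn, and each of the
  three arcs between neighbouring points is shorter than a half circle. Equivalently, the centre
  of the circle lies inside the triangle with vertices at these angles.
\<close>

definition balanced :: "real ^ 3 \<Rightarrow> bool" where
  "balanced b \<longleftrightarrow> b$1 < b$2 \<and> b$2 < b$1 + pi \<and> b$2 < b$3 \<and> b$3 < b$2 + pi \<and>
     b$3 < b$1 + 2 * pi \<and> b$1 + pi < b$3"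

lemma balanced_sin_pos:
  assumes "balanced b"
  shows "sin (b $ (i + 2) - b $ (i + 1)) > 0"
proof -
  have "sin (b$3 - b$2) > 0" "sin (b$2 - b$1) > 0" "sin (b$1 + 2*pi - b$3) > 0"
    using assms by (auto simp: balanced_def intro!: sin_gt_zero)
  moreover have "sin (b$1 + 2*pi - b$3) = sin (b$1 - b$3)"
    using sin_periodic[of "b$1 - b$3"] by (simp add: algebra_simps)
  ultimately show ?thesis using exhaust_3[of i] by auto
qed

lemma interp_det_pos: "balanced b \<Longrightarrow> interp_det b > 0"
  unfolding interp_det_def by (intro sum_pos balanced_sin_pos) auto

lemma interp_scale: "interp b (\<chi> i. c * u $ i) x = c * interp b u x"
  by (simp add: interp_def interp_const_def interp_cos_def interp_sin_def sum_3 algebra_simps add_divide_distrib)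

text \<open>
  Constants interpolate themselves, so passing from heights to depths commutes with interpolation.
\<close>

lemma interp_reflect:
  assumes "interp_det b \<noteq> 0"
  shows "interp b (\<chi> i. 1 - u $ i) x = 1 - interp b u x"
proof -
  have 1: "interp_const b (\<chi> i. 1) = 1" "interp_cos b (\<chi> i. 1) = 0" "interp_sin b (\<chi> i. 1) = 0"
    using interp_unique[OF assms, of "\<chi> i. 1" 1 0 0] by simp_all
  have "interp b (\<chi> i. 1 - u $ i) x = interp b (\<chi> i. 1) x - interp b u x"
    by (simp add: interp_def interp_const_def interp_cos_def interp_sin_def left_diff_distrib sum_subtractf
         diff_divide_distrib right_diff_distrib)
  then show ?thesis by (simp add: interp_def 1)
qed

text \<open>
  The barycentric coordinates of a point are affine in the point, and at the origin they are
  proportional to the sines of the opposite arcs. They stay positive near the origin.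
\<close>

lemma origin_in_triangle:
  assumes b: "balanced b"
  shows "(0, 0) \<in> interior (convex hull (range (\<lambda>i::3. (cos (b $ i), sin (b $ i)))))"
    (is "_ \<in> interior (convex hull ?W)")
proof -
  have D: "interp_det b > 0" using interp_det_pos[OF b] .
  define l where "l i p = (sin (b$(i+2) - b$(i+1)) + fst p * (sin (b$(i+1)) - sin (b$(i+2)))
     + snd p * (cos (b$(i+2)) - cos (b$(i+1)))) / interp_det b" for i :: 3 and p :: "real \<times> real"
  have s1: "(\<Sum>i\<in>UNIV. l i p) = 1" for p
    using D by (simp add: l_def sum_3 add_divide_distrib[symmetric] interp_det_eq algebra_simps)
  have s2: "(\<Sum>i\<in>UNIV. l i p *\<^sub>R (cos (b $ i), sin (b $ i))) = p" for p
  proof -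
    have "interp_det b * (\<Sum>i\<in>UNIV. l i p * cos (b $ i)) = interp_det b * fst p"
      "interp_det b * (\<Sum>i\<in>UNIV. l i p * sin (b $ i)) = interp_det b * snd p"
      using D by (simp_all add: l_def sum_3 distrib_left) (simp_all add: interp_det_eq sin_diff, algebra+)
    then show ?thesis using D
      by (simp add: prod_eq_iff fst_sum snd_sum)
  qed
  have "open {p. 0 < l i p}" for i
    unfolding l_def using D by (intro open_Collect_less continuous_intros) auto
  then have "open (\<Inter>i\<in>UNIV. {p. 0 < l i p})"
    by (intro open_INT) auto
  moreover have "(\<Inter>i\<in>UNIV. {p. 0 < l i p}) \<subseteq> convex hull ?W"
  proof
    fix p assume "p \<in> (\<Inter>i\<in>UNIV. {p. 0 < l i p})"
    then have "(\<Sum>i\<in>UNIV. l i p *\<^sub>R (cos (b $ i), sin (b $ i))) \<in> convex hull ?W"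
      by (intro convex_sum[OF finite convex_convex_hull s1]) (auto intro: hull_inc less_imp_le)
    then show "p \<in> convex hull ?W" unfolding s2 .
  qed
  ultimately have "(\<Inter>i\<in>UNIV. {p. 0 < l i p}) \<subseteq> interior (convex hull ?W)"
    by (rule interior_maximal[rotated])
  moreover have "(0,0) \<in> (\<Inter>i\<in>UNIV. {p. 0 < l i p})"
    using D balanced_sin_pos[OF b] by (auto simp: l_def)
  ultimately show ?thesis by blast
qed

text \<open>
  The plane through the upper ends of three teeth is unique, so the existential quantifier over
  planes becomes an inequality for each of the remaining teeth.
\<close>

lemma supported_by_iff:
  assumes b: "balanced b" and n: "\<And>i. n i \<in> {1..N}"
    and nb: "\<And>i. tooth_base N (n i) = (cos (b $ i), sin (b $ i))"
  shows "supported_by x N n \<longleftrightarrow>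
    (\<forall>j\<in>{1..N} - range n. x j \<le> interp b (\<chi> i. x (n i)) (tooth_angle N j))"
proof -
  let ?u = "\<chi> i. x (n i)"
  have D: "interp_det b \<noteq> 0" using interp_det_pos[OF b] by simp
  let ?l = "\<lambda>(y,z). interp_cos b ?u * y + interp_sin b ?u * z + interp_const b ?u"
  have l: "?l (tooth_base N j) = interp b ?u (tooth_angle N j)" for j
    by (simp add: tooth_base_def interp_def)
  have ln: "?l (tooth_base N (n i)) = x (n i)" for i
    unfolding nb using interp_node[OF D, of ?u i] by (simp add: interp_def)
  have uni: "l = ?l" if aff: "affine_height l" and node: "\<forall>i. l (tooth_base N (n i)) = x (n i)" for l
  proof -
    obtain p q r where l: "l = (\<lambda>(x, y). p * x + q * y + r)"
      using aff unfolding affine_height_def by blast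
    show ?thesis
      using interp_unique[OF D, of ?u r p q] node unfolding l nb by (simp add: algebra_simps)
  qed
  have aff: "affine_height ?l" unfolding affine_height_def by blast
  have "supported_by x N n \<longleftrightarrow> (\<forall>j\<in>{1..N}. x j \<le> ?l (tooth_base N j))"
  proof
    assume "supported_by x N n"
    then obtain l where l: "affine_height l" "\<forall>i. l (tooth_base N (n i)) = x (n i)"
      "\<forall>j\<in>{1..N}. x j \<le> l (tooth_base N j)"
      unfolding supported_by_def by blast
    show "\<forall>j\<in>{1..N}. x j \<le> ?l (tooth_base N j)"
      using l(3) unfolding uni[OF l(1,2)] .
  next
    assume "\<forall>j\<in>{1..N}. x j \<le> ?l (tooth_base N j)"
    moreover have "(0, 0) \<in> interior (convex hull (range (\<lambda>i. tooth_base N (n i))))"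
      unfolding nb by (rule origin_in_triangle[OF b])
    ultimately show "supported_by x N n"
      unfolding supported_by_def using aff ln by blast
  qed
  also have "\<dots> \<longleftrightarrow> (\<forall>j\<in>{1..N} - range n. x j \<le> ?l (tooth_base N j))"
  proof
    assume A: "\<forall>j\<in>{1..N} - range n. x j \<le> ?l (tooth_base N j)"
    show "\<forall>j\<in>{1..N}. x j \<le> ?l (tooth_base N j)"
    proof
      fix j assume "j \<in> {1..N}"
      then show "x j \<le> ?l (tooth_base N j)"
      proof (cases "j \<in> range n")
        case True
        then obtain i where "j = n i" by blast
        then show ?thesis by (simp only: ln)
      next
        case False
        with A \<open>j \<in> {1..N}\<close> show ?thesis by blast
      qed
    qed
  qed blast
  finally show ?thesis unfolding l .
qed

section \<open>The support probability as an integral over three depths\<close>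

lemma borel_measurable_vec_lambda:
  fixes f :: "'n::finite \<Rightarrow> 'a \<Rightarrow> real"
  assumes "\<And>i. f i \<in> borel_measurable M"
  shows "(\<lambda>x. \<chi> i. f i x) \<in> borel_measurable M"
  using assms by (subst borel_measurable_euclidean_space) (auto simp: Basis_vec_def inner_axis)

lemma borel_measurable_vec_component [measurable]:
  "(\<lambda>v :: real ^ 'n. v $ i) \<in> borel_measurable borel"
  by (intro borel_measurable_continuous_onI continuous_intros)

text \<open>
  This identification allows Tonelli's theorem for products of lines to be used on
  \<open>real ^ 'n\<close>.
\<close>

lemma lborel_vec_eq_distr_PiM:
  "(lborel :: (real ^ 'n) measure) = distr (\<Pi>\<^sub>M i\<in>UNIV. lborel) borel (\<lambda>f. \<chi> i. f i)"
proof (rule lborel_eqI)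
  interpret product_sigma_finite "\<lambda>_::'n. lborel :: real measure" ..
  have m: "(\<lambda>f. \<chi> i. f i) \<in> (\<Pi>\<^sub>M (i::'n)\<in>UNIV. lborel :: real measure) \<rightarrow>\<^sub>M (borel :: (real^'n) measure)"
    by (rule borel_measurable_vec_lambda) simp
  fix l u :: "real ^ 'n" assume le: "\<And>b. b \<in> Basis \<Longrightarrow> l \<bullet> b \<le> u \<bullet> b"
  have le': "l $ i \<le> u $ i" for i using le[of "axis i 1"] by (simp add: inner_axis axis_in_Basis_iff)
  have "(\<lambda>f. \<chi> i. f i) -` box l u \<inter> space (\<Pi>\<^sub>M (i::'n)\<in>UNIV. lborel :: real measure)
      = (\<Pi>\<^sub>E i\<in>UNIV. {l $ i<..<u $ i})"
    by (auto simp: mem_box_cart space_PiM PiE_def Pi_def extensional_def)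
  then have "emeasure (distr (\<Pi>\<^sub>M i\<in>UNIV. lborel) borel (\<lambda>f. \<chi> i. f i)) (box l u)
     = (\<Prod>i\<in>UNIV. ennreal (u $ i - l $ i))"
    by (simp only: emeasure_distr[OF m borel_open[OF open_box]] emeasure_PiM[OF finite] sets_lborel
      borel_open[OF open_greaterThanLessThan] emeasure_lborel_Ioo[OF le'])
  also have "\<dots> = ennreal (\<Prod>i\<in>UNIV. (u - l) $ i)"
    by (subst prod_ennreal[symmetric]) (auto simp: le')
  also have "(\<Prod>i\<in>UNIV. (u - l) $ i) = (\<Prod>b\<in>Basis. (u - l) \<bullet> b)"
  proof -
    have B: "(Basis :: (real ^ 'n) set) = (\<lambda>i. axis i 1) ` UNIV" by (auto simp: Basis_vec_def)
    have "inj (\<lambda>i::'n. axis i (1::real))" by (auto simp: inj_on_def axis_eq_axis)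
    then show ?thesis unfolding B by (subst prod.reindex) (simp_all add: inner_axis o_def)
  qed
  finally show "emeasure (distr (\<Pi>\<^sub>M i\<in>UNIV. lborel) borel (\<lambda>f. \<chi> i. f i)) (box l u)
     = (\<Prod>b\<in>Basis. (u - l) \<bullet> b)" .
qed simp

lemma nn_integral_lborel_vec:
  fixes F :: "real ^ 'n \<Rightarrow> ennreal"
  assumes "F \<in> borel_measurable borel"
  shows "(\<integral>\<^sup>+u. F u \<partial>lborel) = (\<integral>\<^sup>+f. F (\<chi> i. f i) \<partial>(\<Pi>\<^sub>M i\<in>UNIV. lborel))"
  by (subst lborel_vec_eq_distr_PiM, rule nn_integral_distr)
    (auto intro!: borel_measurable_vec_lambda assms)

lemma measurable_vec_lambda_lborel:
  "(\<lambda>f. \<chi> i. f i) \<in> (\<Pi>\<^sub>M (i::'n)\<in>UNIV. lborel :: real measure) \<rightarrow>\<^sub>M (borel :: (real^'n) measure)"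
  by (rule borel_measurable_vec_lambda) simp

abbreviation unif01 :: "real measure" where
  "unif01 \<equiv> uniform_measure lborel {0..1}"

lemma prob_space_unif01: "prob_space unif01"
  by (rule prob_space_uniform_measure) auto

lemma ennreal_divide_1: "(x :: ennreal) / 1 = x"
  unfolding divide_ennreal_def by simp

lemma emeasure_unif01_atMost: "emeasure unif01 {..t} = ennreal (max 0 (min 1 t))"
proof -
  have "{0..1} \<inter> {..t} = {0..min 1 t}" by auto
  then show ?thesis
    by (cases "t < 0") (auto simp: emeasure_lborel_Icc_eq ennreal_divide_1)
qed

text \<open>
  On a finite product the uniform law on the unit cube is Lebesgue measure restricted to the cube,
  since both measures agree on boxes.
\<close>

lemma PiM_unif01:
  "(\<Pi>\<^sub>M (i::'n::finite)\<in>UNIV. unif01) = density (\<Pi>\<^sub>M i\<in>UNIV. lborel) (indicator (\<Pi>\<^sub>E i\<in>UNIV. {0..1}))"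
proof -
  interpret L: product_sigma_finite "\<lambda>_::'n. lborel :: real measure" ..
  interpret U: prob_space unif01 by (rule prob_space_unif01)
  interpret U: product_sigma_finite "\<lambda>_::'n. unif01" ..
  have "density (\<Pi>\<^sub>M (i::'n)\<in>UNIV. lborel) (indicator (\<Pi>\<^sub>E i\<in>UNIV. {0..1})) = (\<Pi>\<^sub>M (i::'n)\<in>UNIV. unif01)"
  proof (rule U.PiM_eqI)
    show "sets (density (\<Pi>\<^sub>M (i::'n)\<in>UNIV. lborel) (indicator (\<Pi>\<^sub>E i\<in>UNIV. {0..1})))
      = sets (\<Pi>\<^sub>M (i::'n)\<in>UNIV. unif01)"
      by (simp, rule sets_PiM_cong) auto
    fix A :: "'n \<Rightarrow> real set" assume A: "\<And>i. i \<in> UNIV \<Longrightarrow> A i \<in> sets unif01"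
    then have A': "A i \<in> sets borel" for i by auto
    have "emeasure (density (\<Pi>\<^sub>M (i::'n)\<in>UNIV. lborel) (indicator (\<Pi>\<^sub>E i\<in>UNIV. {0..1}))) (Pi\<^sub>E UNIV A)
      = emeasure (\<Pi>\<^sub>M (i::'n)\<in>UNIV. lborel) ((\<Pi>\<^sub>E i\<in>UNIV. {0..1}) \<inter> Pi\<^sub>E UNIV A)"
      using A' by (subst emeasure_density)
        (auto simp: indicator_inter_arith[symmetric] intro!: sets_PiM_I_finite borel_measurable_indicator
          nn_integral_indicator)
    also have "(\<Pi>\<^sub>E i\<in>UNIV. {0..1}) \<inter> Pi\<^sub>E UNIV A = (\<Pi>\<^sub>E i\<in>UNIV. {0..1} \<inter> A i)"
      by (rule PiE_Int)
    also have "emeasure (\<Pi>\<^sub>M (i::'n)\<in>UNIV. lborel) \<dots> = (\<Prod>i\<in>UNIV. emeasure lborel ({0..1} \<inter> A i))"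
      using A' by (intro L.emeasure_PiM) auto
    also have "\<dots> = (\<Prod>i\<in>UNIV. emeasure unif01 (A i))"
      using A' by (intro prod.cong) (auto simp: emeasure_uniform_measure ennreal_divide_1)
    finally show "emeasure (density (\<Pi>\<^sub>M (i::'n)\<in>UNIV. lborel) (indicator (\<Pi>\<^sub>E i\<in>UNIV. {0..1}))) (Pi\<^sub>E UNIV A)
      = (\<Prod>i\<in>UNIV. emeasure unif01 (A i))" .
  qed simp
  then show ?thesis by simp
qed

lemma nn_integral_PiM_unif01:
  fixes F :: "real ^ 'n \<Rightarrow> ennreal"
  assumes F: "F \<in> borel_measurable borel"
  shows "(\<integral>\<^sup>+f. F (\<chi> i. f i) \<partial>(\<Pi>\<^sub>M i\<in>UNIV. unif01)) = (\<integral>\<^sup>+u. indicator (cbox 0 1) u * F u \<partial>lborel)"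
proof -
  note [measurable] = measurable_compose[OF measurable_vec_lambda_lborel F]
  have "(\<integral>\<^sup>+f. F (\<chi> i. f i) \<partial>(\<Pi>\<^sub>M i\<in>UNIV. unif01)) =
    (\<integral>\<^sup>+f. indicator (\<Pi>\<^sub>E i\<in>UNIV. {0..1}) f * F (\<chi> i. f i) \<partial>(\<Pi>\<^sub>M i\<in>UNIV. lborel))"
    unfolding PiM_unif01
    by (subst nn_integral_density) (auto intro!: borel_measurable_indicator sets_PiM_I_finite)
  also have "\<dots> = (\<integral>\<^sup>+f. (indicator (cbox 0 1) (\<chi> i. f i) * F (\<chi> i. f i)) \<partial>(\<Pi>\<^sub>M i\<in>UNIV. lborel))"
    by (intro nn_integral_cong arg_cong2[where f="(*)"])
      (auto simp: indicator_def mem_box_cart PiE_def Pi_def extensional_def)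
  also have "\<dots> = (\<integral>\<^sup>+u. indicator (cbox 0 1) u * F u \<partial>lborel)"
    using F by (subst nn_integral_lborel_vec) auto
  finally show ?thesis .
qed

lemma borel_measurable_interp [measurable]: "(\<lambda>u. interp b u x) \<in> borel_measurable borel"
  unfolding interp_def interp_const_def interp_cos_def interp_sin_def divide_inverse
  by (intro borel_measurable_continuous_onI continuous_intros)

text \<open>
  The joint law of the lengths is a product measure. Splitting the product into the three
  supporting teeth and the others, the inner integral is the measure of a box, because the
  supporting lengths determine the plane.
\<close>

lemma support_prob_eq_integral:
  assumes comb: "random_comb M X" and N: "N \<ge> 3"
    and b: "balanced b" and inj: "inj n" and n: "\<And>i. n i \<in> {1..N}"
    and nb: "\<And>i. tooth_base N (n i) = (cos (b $ i), sin (b $ i))"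
  shows "ennreal (support_prob M X N n) =
    (\<integral>\<^sup>+y. indicator (cbox 0 1) y *
       (\<Prod>j\<in>{1..N} - range n. ennreal (max 0 (min 1 (interp b y (tooth_angle N j))))) \<partial>lborel)"
proof -
  let ?K = "range n" and ?A = "{1..N} - range n"
  interpret P: prob_space "M N" using comb N by (simp add: random_comb_def)
  interpret U: prob_space unif01 by (rule prob_space_unif01)
  interpret U: product_sigma_finite "\<lambda>_::nat. unif01" ..
  have ind: "P.indep_vars (\<lambda>_. borel) (X N) {1..N}"
    and dist: "\<And>j. j \<in> {1..N} \<Longrightarrow> distr (M N) borel (X N j) = unif01"
    using comb N by (auto simp: random_comb_def)
  have rv: "X N j \<in> borel_measurable (M N)" if "j \<in> {1..N}" for j
    using ind that by (auto simp: P.indep_vars_def)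
  have KA: "?K \<inter> ?A = {}" "finite ?K" "finite ?A" "?K \<union> ?A = {1..N}" using n by auto
  have distr_eq: "distr (M N) (\<Pi>\<^sub>M j\<in>{1..N}. borel) (\<lambda>\<omega>. \<lambda>j\<in>{1..N}. X N j \<omega>) = (\<Pi>\<^sub>M j\<in>{1..N}. unif01)"
  proof -
    have "distr (M N) (\<Pi>\<^sub>M j\<in>{1..N}. borel) (\<lambda>\<omega>. \<lambda>j\<in>{1..N}. X N j \<omega>)
        = (\<Pi>\<^sub>M j\<in>{1..N}. distr (M N) borel (X N j))"
      using P.indep_vars_iff_distr_eq_PiM'[where I="{1..N}" and M'="\<lambda>_. borel" and X="X N"] ind rv N by auto
    also have "\<dots> = (\<Pi>\<^sub>M j\<in>{1..N}. unif01)"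
      by (rule PiM_cong[OF refl dist])
    finally show ?thesis .
  qed
  let ?B = "{x \<in> space (\<Pi>\<^sub>M j\<in>{1..N}. borel).
      \<forall>j\<in>?A. x j \<le> interp b (\<chi> i. x (n i)) (tooth_angle N j)}"
  have vec: "(\<lambda>x. \<chi> i. x (n i)) \<in> (\<Pi>\<^sub>M j\<in>{1..N}. borel) \<rightarrow>\<^sub>M (borel :: (real^3) measure)"
    by (rule borel_measurable_vec_lambda) (use n in auto)
  have comp: "(\<lambda>x. x j) \<in> borel_measurable (\<Pi>\<^sub>M j\<in>{1..N}. borel :: real measure)" if "j \<in> {1..N}" for j
    using that by simp
  have B: "?B \<in> sets (\<Pi>\<^sub>M j\<in>{1..N}. borel)"
    using comp by (intro sets.sets_Collect_finite_All borel_measurable_le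
       measurable_compose[OF vec borel_measurable_interp]) auto
  have setsU: "sets (\<Pi>\<^sub>M j\<in>{1..N}. unif01) = sets (\<Pi>\<^sub>M j\<in>{1..N}. borel)"
    by (rule sets_PiM_cong) auto
  have BU: "?B \<in> sets (\<Pi>\<^sub>M j\<in>?K \<union> ?A. unif01)"
    using B unfolding KA(4) setsU .
  have "ennreal (support_prob M X N n) =
     emeasure (M N) {\<omega> \<in> space (M N). supported_by (\<lambda>j. X N j \<omega>) N n}"
    by (simp add: support_prob_def P.emeasure_eq_measure)
  also have "{\<omega> \<in> space (M N). supported_by (\<lambda>j. X N j \<omega>) N n} =
     (\<lambda>\<omega>. \<lambda>j\<in>{1..N}. X N j \<omega>) -` ?B \<inter> space (M N)"
    using n unfolding supported_by_iff[OF b n nb] by (auto simp: space_PiM)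
  also have "emeasure (M N) \<dots> = emeasure (\<Pi>\<^sub>M j\<in>{1..N}. unif01) ?B"
    unfolding distr_eq[symmetric] by (subst emeasure_distr[OF _ B]) (auto intro!: measurable_restrict rv)
  also have "\<dots> = (\<integral>\<^sup>+x. indicator ?B x \<partial>(\<Pi>\<^sub>M j\<in>?K \<union> ?A. unif01))"
    unfolding nn_integral_indicator[OF BU] unfolding KA(4) ..
  also have "\<dots> = (\<integral>\<^sup>+x. (\<integral>\<^sup>+y. indicator ?B (merge ?K ?A (x, y)) \<partial>(\<Pi>\<^sub>M j\<in>?A. unif01)) \<partial>(\<Pi>\<^sub>M j\<in>?K. unif01))"
    using BU by (intro U.product_nn_integral_fold KA borel_measurable_indicator)
  also have "\<dots> = (\<integral>\<^sup>+x. (\<Prod>j\<in>?A. ennreal (max 0 (min 1 (interp b (\<chi> i. x (n i)) (tooth_angle N j)))))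
       \<partial>(\<Pi>\<^sub>M j\<in>?K. unif01))"
  proof (intro nn_integral_cong)
    fix x :: "nat \<Rightarrow> real" assume x: "x \<in> space (\<Pi>\<^sub>M j\<in>?K. unif01)"
    let ?h = "\<lambda>j. interp b (\<chi> i. x (n i)) (tooth_angle N j)"
    have "(\<integral>\<^sup>+y. indicator ?B (merge ?K ?A (x, y)) \<partial>(\<Pi>\<^sub>M j\<in>?A. unif01))
      = (\<integral>\<^sup>+y. indicator (\<Pi>\<^sub>E j\<in>?A. {..?h j}) y \<partial>(\<Pi>\<^sub>M j\<in>?A. unif01))"
    proof (intro nn_integral_cong)
      fix y :: "nat \<Rightarrow> real" assume "y \<in> space (\<Pi>\<^sub>M j\<in>?A. unif01)"
      then have y: "y \<in> extensional ?A" by (simp add: space_PiM PiE_def)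
      let ?m = "merge ?K ?A (x, y)"
      have "?m \<in> extensional (?K \<union> ?A)" by (rule extensional_merge)
      then have sp: "?m \<in> space (\<Pi>\<^sub>M j\<in>{1..N}. borel)" unfolding KA(4) by (simp add: space_PiM PiE_def)
      have mK: "?m (n i) = x (n i)" for i by (simp add: merge_def)
      have mA: "?m j = y j" if "j \<in> ?A" for j using that unfolding merge_def by simp
      have "?m \<in> ?B \<longleftrightarrow> (\<forall>j\<in>?A. ?m j \<le> ?h j)"
        using sp unfolding mem_Collect_eq mK by (simp only: simp_thms)
      also have "\<dots> \<longleftrightarrow> (\<forall>j\<in>?A. y j \<le> ?h j)"
        by (intro ball_cong refl) (simp only: mA)
      also have "\<dots> \<longleftrightarrow> y \<in> (\<Pi>\<^sub>E j\<in>?A. {..?h j})"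
        using y unfolding PiE_iff atMost_iff by blast
      finally have "?m \<in> ?B \<longleftrightarrow> y \<in> (\<Pi>\<^sub>E j\<in>?A. {..?h j})" .
      then show "indicator ?B (merge ?K ?A (x, y)) = indicator (\<Pi>\<^sub>E j\<in>?A. {..?h j}) y"
        by (simp only: indicator_def)
    qed
    also have "\<dots> = (\<Prod>j\<in>?A. emeasure unif01 {..?h j})"
    proof -
      have S: "(\<Pi>\<^sub>E j\<in>?A. {..?h j}) \<in> sets (\<Pi>\<^sub>M j\<in>?A. unif01)"
        by (rule sets_PiM_I_finite) auto
      show ?thesis unfolding nn_integral_indicator[OF S] by (rule U.emeasure_PiM) auto
    qed
    finally show "(\<integral>\<^sup>+y. indicator ?B (merge ?K ?A (x, y)) \<partial>(\<Pi>\<^sub>M j\<in>?A. unif01))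
       = (\<Prod>j\<in>?A. ennreal (max 0 (min 1 (?h j))))"
      unfolding emeasure_unif01_atMost .
  qed
  also have "\<dots> = (\<integral>\<^sup>+f. (\<Prod>j\<in>?A. ennreal (max 0 (min 1 (interp b (\<chi> i. f i) (tooth_angle N j)))))
       \<partial>(\<Pi>\<^sub>M i\<in>(UNIV::3 set). unif01))"
  proof -
    let ?F = "\<lambda>f. \<Prod>j\<in>?A. ennreal (max 0 (min 1 (interp b (\<chi> i. f i) (tooth_angle N j))))"
    have *: "(\<Pi>\<^sub>M i\<in>(UNIV::3 set). unif01) =
      distr (\<Pi>\<^sub>M j\<in>?K. unif01) (\<Pi>\<^sub>M i\<in>(UNIV::3 set). unif01) (\<lambda>\<omega>. \<lambda>i\<in>UNIV. \<omega> (n i))"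
      using distr_PiM_reindex[of ?K "\<lambda>_. unif01" n UNIV] inj prob_space_unif01 by auto
    have F: "?F \<in> borel_measurable (\<Pi>\<^sub>M i\<in>(UNIV::3 set). unif01)"
      by (intro borel_measurable_prod_ennreal measurable_compose[OF _ measurable_ennreal] borel_measurable_max
          borel_measurable_min measurable_compose[OF _ borel_measurable_interp] borel_measurable_vec_lambda) auto
    have r: "(\<lambda>\<omega>. \<lambda>i\<in>UNIV. \<omega> (n i)) \<in> (\<Pi>\<^sub>M j\<in>?K. unif01) \<rightarrow>\<^sub>M (\<Pi>\<^sub>M i\<in>(UNIV::3 set). unif01)"
      by (intro measurable_restrict) auto
    have "integral\<^sup>N (distr (\<Pi>\<^sub>M j\<in>?K. unif01) (\<Pi>\<^sub>M i\<in>(UNIV::3 set). unif01) (\<lambda>\<omega>. \<lambda>i\<in>UNIV. \<omega> (n i))) ?F =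
      (\<integral>\<^sup>+x. ?F (\<lambda>i\<in>UNIV. x (n i)) \<partial>(\<Pi>\<^sub>M j\<in>?K. unif01))"
      by (rule nn_integral_distr[OF r]) (use F in simp)
    then show ?thesis unfolding *[symmetric] by simp
  qed
  also have "\<dots> = (\<integral>\<^sup>+y. indicator (cbox 0 1) y *
       (\<Prod>j\<in>?A. ennreal (max 0 (min 1 (interp b y (tooth_angle N j))))) \<partial>lborel)"
    by (rule nn_integral_PiM_unif01) measurable
  finally show ?thesis .
qed

text \<open>
  The substitution \<open>y = 1 - (2\<pi>/N) u\<close> passes from lengths to rescaled depths and absorbs the
  normalising factor \<open>(N/(2\<pi>))\<^sup>3\<close>.
\<close>

lemma scaled_support_prob:
  assumes comb: "random_comb M X" and N: "N \<ge> 3"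
    and b: "balanced b" and inj: "inj n" and n: "\<And>i. n i \<in> {1..N}"
    and nb: "\<And>i. tooth_base N (n i) = (cos (b $ i), sin (b $ i))"
  shows "ennreal ((real N / (2 * pi)) ^ 3 * support_prob M X N n) =
    (\<integral>\<^sup>+u. indicator {u. \<forall>i. 0 \<le> u $ i \<and> u $ i \<le> real N / (2 * pi)} u *
       (\<Prod>j\<in>{1..N} - range n.
          ennreal (max 0 (min 1 (1 - 2 * pi / real N * interp b u (tooth_angle N j))))) \<partial>lborel)"
proof -
  let ?c = "2 * pi / real N"
  have N0: "N > 0" using N by simp
  then have c: "?c > 0" by simp
  have D: "interp_det b \<noteq> 0" using interp_det_pos[OF b] by simp
  let ?F = "\<lambda>y. indicator (cbox 0 1) y *
       (\<Prod>j\<in>{1..N} - range n. ennreal (max 0 (min 1 (interp b y (tooth_angle N j)))))"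
  have [measurable]: "?F \<in> borel_measurable borel" by measurable
  let ?T = "\<lambda>u::real^3. 1 + (- ?c) *\<^sub>R u"
  have "ennreal (support_prob M X N n) = (\<integral>\<^sup>+y. ?F y \<partial>lborel)"
    by (rule support_prob_eq_integral[OF assms])
  also have "\<dots> = ennreal (?c ^ 3) * (\<integral>\<^sup>+u. ?F (?T u) \<partial>lborel)"
    using N0 by (subst lborel_affine[of "- ?c" 1])
       (auto simp: nn_integral_density nn_integral_distr nn_integral_cmult)
  finally have "ennreal ((1 / ?c) ^ 3) * ennreal (support_prob M X N n) =
     ennreal ((1 / ?c) ^ 3) * ennreal (?c ^ 3) * (\<integral>\<^sup>+u. ?F (?T u) \<partial>lborel)"
    by (simp add: mult.assoc)
  also have "ennreal ((1 / ?c) ^ 3) * ennreal (?c ^ 3) = 1"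
    using N0 by (subst ennreal_mult[symmetric]) (auto simp: power_mult_distrib[symmetric] simp del: power_divide)
  finally have "ennreal ((real N / (2 * pi)) ^ 3 * support_prob M X N n) = (\<integral>\<^sup>+u. ?F (?T u) \<partial>lborel)"
    by (subst ennreal_mult) (auto simp: support_prob_def)
  also have "\<dots> = (\<integral>\<^sup>+u. indicator {u. \<forall>i. 0 \<le> u $ i \<and> u $ i \<le> real N / (2 * pi)} u *
       (\<Prod>j\<in>{1..N} - range n.
          ennreal (max 0 (min 1 (1 - 2 * pi / real N * interp b u (tooth_angle N j))))) \<partial>lborel)"
  proof (intro nn_integral_cong arg_cong2[where f="(*)"] prod.cong refl)
    fix u :: "real ^ 3"
    have T: "?T u = (\<chi> i. 1 - (\<chi> i. ?c * u $ i) $ i)" by (simp add: vec_eq_iff)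
    have "0 \<le> 1 - ?c * t \<and> 1 - ?c * t \<le> 1 \<longleftrightarrow> 0 \<le> t \<and> t \<le> real N / (2 * pi)" for t
    proof -
      have "1 - ?c * t \<le> 1 \<longleftrightarrow> 0 \<le> t" using c by (simp only: diff_le_eq le_add_same_cancel1 zero_le_mult_iff) auto
      moreover have "0 \<le> 1 - ?c * t \<longleftrightarrow> t \<le> real N / (2 * pi)" using N by (simp add: field_simps)
      ultimately show ?thesis by blast
    qed
    then show "indicator (cbox 0 1) (?T u) = indicator {u. \<forall>i. 0 \<le> u $ i \<and> u $ i \<le> real N / (2 * pi)} u"
      by (simp add: indicator_def mem_box_cart)
    show "ennreal (max 0 (min 1 (interp b (?T u) x))) = ennreal (max 0 (min 1 (1 - ?c * interp b u x)))" for x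
      unfolding T interp_reflect[OF D] interp_scale ..
  qed
  finally show ?thesis .
qed

section \<open>Change of variables and iterated integrals in three dimensions\<close>

text \<open>
  The change of variables theorem for a nonnegative function whose pulled-back integral is finite,
  in terms of nonnegative integrals. The image \<open>g ` S\<close> need
  not be Borel, whence Lebesgue measure on the left.
\<close>

lemma nn_integral_change_of_variables:
  fixes f :: "real^'n::{finite,wellorder} \<Rightarrow> real" and g :: "real^'n::_ \<Rightarrow> real^'n::_"
  assumes S: "S \<in> sets borel"
    and der_g: "\<And>x. x \<in> S \<Longrightarrow> (g has_derivative g' x) (at x within S)"
    and inj: "inj_on g S"
    and f: "\<And>x. 0 \<le> f x"
    and meas: "(\<lambda>x. \<bar>det (matrix (g' x))\<bar> * f (g x)) \<in> borel_measurable borel"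
    and fin: "(\<integral>\<^sup>+x\<in>S. ennreal (\<bar>det (matrix (g' x))\<bar> * f (g x)) \<partial>lborel) = ennreal c" "0 \<le> c"
  shows "(\<integral>\<^sup>+y\<in>g ` S. ennreal (f y) \<partial>lebesgue) = ennreal c"
proof -
  \<comment> \<open>The theorem on vector-valued functions is applied to a function with values in \<open>real ^ 1\<close>.\<close>
  let ?p = "\<lambda>x. \<bar>det (matrix (g' x))\<bar> * f (g x)"
  let ?f1 = "\<lambda>y. (\<chi> i. f y) :: real^1"
  have nn: "(\<integral>\<^sup>+x. ennreal (indicator S x * ?p x) \<partial>lebesgue) = ennreal c"
    using S meas fin(1)
    by (subst nn_integral_completion)
      (auto simp: ennreal_mult'' f ennreal_indicator[symmetric] mult.commute intro!: borel_measurable_times)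
  have int: "integrable lebesgue (\<lambda>x. indicator S x * ?p x)"
    using S meas nn f fin(2)
    by (intro integrableI_nn_integral_finite[OF _ _ nn] measurable_completion) auto
  have val: "(LINT x|lebesgue. indicator S x * ?p x) = c"
    using nn nn_integral_eq_integral[OF int] f fin(2) by (simp add: integral_nonneg_AE)
  have lin: "bounded_linear (\<lambda>t. (\<chi> i. t) :: real^1)"
    by (simp add: linear_conv_bounded_linear[symmetric] linear_iff vec_eq_iff)
  have eq1: "indicator S x *\<^sub>R (\<bar>det (matrix (g' x))\<bar> *\<^sub>R ?f1 (g x)) = (\<chi> i. indicator S x * ?p x)" for x
    by (simp add: vec_eq_iff)
  have int1: "(\<lambda>x. \<bar>det (matrix (g' x))\<bar> *\<^sub>R ?f1 (g x)) absolutely_integrable_on S"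
    unfolding set_integrable_def eq1 using integrable_bounded_linear[OF lin int] .
  have "integral S (\<lambda>x. \<bar>det (matrix (g' x))\<bar> *\<^sub>R ?f1 (g x)) = (\<chi> i. c)"
    unfolding set_lebesgue_integral_eq_integral(2)[OF int1, symmetric] set_lebesgue_integral_def eq1
    using integral_bounded_linear[OF lin int] val by simp
  then have img: "?f1 absolutely_integrable_on (g ` S)" "integral (g ` S) ?f1 = (\<chi> i. c)"
    using has_absolute_integral_change_of_variables[OF _ der_g inj, of ?f1 "\<chi> i. c"] S int1 by auto
  have lin2: "bounded_linear (\<lambda>v::real^1. v $ 1)" by (rule bounded_linear_vec_nth)
  have eq2: "(indicator (g ` S) y *\<^sub>R ?f1 y) $ 1 = indicator (g ` S) y * f y" for y by simp
  have int2: "integrable lebesgue (\<lambda>y. indicator (g ` S) y * f y)"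
    using integrable_bounded_linear[OF lin2 img(1)[unfolded set_integrable_def]] unfolding eq2 .
  have "(LINT y|lebesgue. indicator (g ` S) y * f y) = c"
    using integral_bounded_linear[OF lin2 img(1)[unfolded set_integrable_def]] img(2)
    unfolding set_lebesgue_integral_eq_integral(2)[OF img(1), symmetric] set_lebesgue_integral_def eq2 by simp
  then have "(\<integral>\<^sup>+y. ennreal (indicator (g ` S) y * f y) \<partial>lebesgue) = ennreal c"
    using nn_integral_eq_integral[OF int2] f by simp
  then show ?thesis
    by (simp add: ennreal_mult'' f ennreal_indicator[symmetric] mult.commute)
qed

text \<open>
  The middle coordinate is integrated first. It will be the factor \<open>\<rho>\<close>, whose integral is
  explicit for fixed values of the other two.
\<close>

lemma nn_integral_lborel_vec3:
  fixes F :: "real ^ 3 \<Rightarrow> ennreal"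
  assumes F: "F \<in> borel_measurable borel"
  shows "(\<integral>\<^sup>+v. F v \<partial>lborel) = (\<integral>\<^sup>+q. \<integral>\<^sup>+\<psi>. \<integral>\<^sup>+\<rho>. F (vector [q, \<rho>, \<psi>]) \<partial>lborel \<partial>lborel \<partial>lborel)"
proof -
  interpret L: product_sigma_finite "\<lambda>_::3. lborel :: real measure" ..
  have U: "(UNIV :: 3 set) = insert 1 (insert 3 (insert 2 {}))" using UNIV_3 by auto
  have m: "(\<lambda>f. F (\<chi> i. f i)) \<in> borel_measurable (\<Pi>\<^sub>M (i::3)\<in>UNIV. lborel :: real measure)"
    by (rule measurable_compose[OF measurable_vec_lambda_lborel F])
  note mU = m[unfolded U]
  have m1: "(\<lambda>x. x(i := c)) \<in> (\<Pi>\<^sub>M (i::3)\<in>I. lborel :: real measure) \<rightarrow>\<^sub>M (\<Pi>\<^sub>M (i::3)\<in>insert i I. lborel)" for i c I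
    by (rule measurable_fun_upd[where J=I]) auto
  have "(\<integral>\<^sup>+v. F v \<partial>lborel) = (\<integral>\<^sup>+f. F (\<chi> i. f i) \<partial>(\<Pi>\<^sub>M i\<in>insert 1 (insert 3 (insert 2 {})). lborel))"
    unfolding nn_integral_lborel_vec[OF F] U ..
  also have "\<dots> = (\<integral>\<^sup>+q. \<integral>\<^sup>+f. F (\<chi> i. (f(1 := q)) i) \<partial>(\<Pi>\<^sub>M i\<in>insert 3 (insert 2 {}). lborel) \<partial>lborel)"
    by (rule L.product_nn_integral_insert_rev[OF _ _ mU]) auto
  also have "\<dots> = (\<integral>\<^sup>+q. \<integral>\<^sup>+\<psi>. \<integral>\<^sup>+f. F (\<chi> i. (f(3 := \<psi>, 1 := q)) i) \<partial>(\<Pi>\<^sub>M i\<in>insert 2 {}. lborel) \<partial>lborel \<partial>lborel)"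
    by (intro nn_integral_cong L.product_nn_integral_insert_rev measurable_compose[OF m1 mU]) auto
  also have "\<dots> = (\<integral>\<^sup>+q. \<integral>\<^sup>+\<psi>. \<integral>\<^sup>+\<rho>. \<integral>\<^sup>+f. F (\<chi> i. (f(2 := \<rho>, 3 := \<psi>, 1 := q)) i)
       \<partial>(\<Pi>\<^sub>M i\<in>{}. lborel) \<partial>lborel \<partial>lborel \<partial>lborel)"
    by (intro nn_integral_cong L.product_nn_integral_insert_rev
        measurable_compose[OF m1 measurable_compose[OF m1 mU]]) auto
  also have "\<dots> = (\<integral>\<^sup>+q. \<integral>\<^sup>+\<psi>. \<integral>\<^sup>+\<rho>. F (vector [q, \<rho>, \<psi>]) \<partial>lborel \<partial>lborel \<partial>lborel)"
  proof (intro nn_integral_cong)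
    fix q \<psi> \<rho> :: real
    have "(\<chi> i::3. ((\<lambda>_. undefined)(2 := \<rho>, 3 := \<psi>, 1 := q)) i) = vector [q, \<rho>, \<psi>]"
      by (simp add: vec_eq_iff forall_3)
    then show "(\<integral>\<^sup>+f. F (\<chi> i. (f(2 := \<rho>, 3 := \<psi>, 1 := q)) i) \<partial>(\<Pi>\<^sub>M i\<in>{}. lborel)) = F (vector [q, \<rho>, \<psi>])"
      by (simp add: PiM_empty nn_integral_count_space_finite)
  qed
  finally show ?thesis .
qed

section \<open>Polar coordinates for planes\<close>

text \<open>
  The function \<open>H\<close> of the introduction: the area of the part of the cylinder over the unit circle
  that lies between the level \<open>0\<close> and the graph of \<open>q - cos x\<close>, where the latter is positive.
\<close>

definition unit_wall_area :: "real \<Rightarrow> real" where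
  "unit_wall_area q = integral {0..2 * pi} (\<lambda>x. max 0 (q - cos x))"

lemma unit_wall_area_integrable: "(\<lambda>x. max 0 (q - cos x)) integrable_on {a..b :: real}"
  by (intro integrable_continuous_real continuous_intros)

lemma mono_unit_wall_area: "mono unit_wall_area"
  unfolding unit_wall_area_def by (intro monoI integral_le unit_wall_area_integrable) auto

lemma integral_periodic_shift:
  fixes h :: "real \<Rightarrow> real"
  assumes cont: "continuous_on UNIV h" and per: "\<And>x. h (x + p) = h x" and p: "p > 0"
  shows "integral {0..p} (\<lambda>x. h (x - c)) = integral {0..p} h"
proof -
  have cont': "continuous_on S h" for S using cont continuous_on_subset by blast
  have per_int: "h (x + of_int k * p) = h x" for x k
  proof (induction k rule: int_induct[where k=0])
    case (step1 i)
    then show ?case using per[of "x + of_int i * p"] by (simp add: algebra_simps)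
  next
    case (step2 i)
    then show ?case using per[of "x + of_int (i - 1) * p"] by (simp add: algebra_simps)
  qed simp
  define k where "k = \<lfloor>- c / p\<rfloor>"
  \<comment> \<open>The shift by \<open>- c\<close> reduced modulo the period.\<close>
  define d where "d = - c - of_int k * p"
  have d: "0 \<le> d" "d < p"
    using p floor_divide_lower[of p "- c"] floor_divide_upper[of p "- c"]
    by (auto simp: d_def k_def algebra_simps)
  have "h (x - c) = h (x + d)" for x
    using per_int[of "x + d" k] by (simp add: d_def algebra_simps)
  then have "integral {0..p} (\<lambda>x. h (x - c)) = integral {0..p} (h \<circ> (\<lambda>x. x + d))"
    by (simp add: o_def)
  also have "\<dots> = integral {d..p + d} h"
    using integral_shift[of 0 d p h] cont' by simp
  also have "\<dots> = integral {d..p} h + integral {p..p + d} h"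
    using d p Henstock_Kurzweil_Integration.integral_combine[where a=d and c=p and b="p + d" and f=h] integrable_continuous_real[OF cont'] by simp
  also have "integral {p..p + d} h = integral {0..d} (h \<circ> (\<lambda>x. x + p))"
    using integral_shift[of 0 p d h] cont' by (simp add: add.commute)
  also have "\<dots> = integral {0..d} h"
    by (simp add: o_def per)
  also have "integral {d..p} h + integral {0..d} h = integral {0..p} h"
    using Henstock_Kurzweil_Integration.integral_combine[where a=0 and c=d and b=p and f=h] d integrable_continuous_real[OF cont'] by simp
  finally show ?thesis .
qed

text \<open>
  By periodicity the direction \<open>\<psi>\<close> of the plane does not affect the area.
\<close>

lemma integral_unit_wall_area_shift:
  assumes "\<rho> \<ge> 0"
  shows "integral {0..2 * pi} (\<lambda>x. max 0 (\<rho> * (q - cos (x - \<psi>)))) = \<rho> * unit_wall_area q"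
proof -
  have "max 0 (\<rho> * t) = \<rho> * max 0 t" for t
    using assms by (auto simp: max_def mult_le_0_iff zero_le_mult_iff)
  then have "integral {0..2 * pi} (\<lambda>x. max 0 (\<rho> * (q - cos (x - \<psi>))))
     = \<rho> * integral {0..2 * pi} (\<lambda>x. max 0 (q - cos (x - \<psi>)))"
    by simp
  also have "integral {0..2 * pi} (\<lambda>x. max 0 (q - cos (x - \<psi>))) = unit_wall_area q"
    unfolding unit_wall_area_def
    by (rule integral_periodic_shift[where h="\<lambda>x. max 0 (q - cos x)"])
      (auto intro!: continuous_intros)
  finally show ?thesis .
qed

text \<open>
  With \<open>v = (q, \<rho>, \<psi>)\<close>, these are the values at the three angles of the polynomial
  \<open>\<rho> (q - cos (x - \<psi>))\<close>.
\<close>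

definition polar_plane :: "real ^ 3 \<Rightarrow> real ^ 3 \<Rightarrow> real ^ 3" where
  "polar_plane b v = (\<chi> i. v $ 2 * (v $ 1 - cos (b $ i - v $ 3)))"

text \<open>
  The half-open range of the direction makes the parametrisation injective, and the last
  condition says that the three values are nonnegative.
\<close>

definition polar_domain :: "real ^ 3 \<Rightarrow> (real ^ 3) set" where
  "polar_domain b = {v. v $ 2 > 0 \<and> b $ 1 \<le> v $ 3 \<and> v $ 3 < b $ 1 + 2 * pi \<and>
     (\<forall>i. cos (b $ i - v $ 3) \<le> v $ 1)}"

lemma interp_polar_plane:
  assumes D: "interp_det b \<noteq> 0"
  shows "interp b (polar_plane b v) x = v $ 2 * (v $ 1 - cos (x - v $ 3))"
    and "interp_const b (polar_plane b v) = v $ 2 * v $ 1"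
    and "interp_cos b (polar_plane b v) = - v $ 2 * cos (v $ 3)"
    and "interp_sin b (polar_plane b v) = - v $ 2 * sin (v $ 3)"
proof -
  have *: "polar_plane b v $ i = v $ 2 * v $ 1 + (- v $ 2 * cos (v $ 3)) * cos (b $ i)
     + (- v $ 2 * sin (v $ 3)) * sin (b $ i)" for i
    by (simp add: polar_plane_def cos_diff algebra_simps)
  note ** = interp_unique[OF D *]
  show "interp_const b (polar_plane b v) = v $ 2 * v $ 1"
    "interp_cos b (polar_plane b v) = - v $ 2 * cos (v $ 3)"
    "interp_sin b (polar_plane b v) = - v $ 2 * sin (v $ 3)" by (rule **)+
  show "interp b (polar_plane b v) x = v $ 2 * (v $ 1 - cos (x - v $ 3))"
    unfolding interp_def ** by (simp add: cos_diff algebra_simps)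
qed

text \<open>
  The values at three points determine the polynomial, hence \<open>\<rho> q\<close> and the vector with polar
  coordinates \<open>(\<rho>, \<psi>)\<close>.
\<close>

lemma inj_on_polar_plane:
  assumes D: "interp_det b \<noteq> 0"
  shows "inj_on (polar_plane b) (polar_domain b)"
proof (rule inj_onI)
  fix v w assume v: "v \<in> polar_domain b" and w: "w \<in> polar_domain b"
    and eq: "polar_plane b v = polar_plane b w"
  have pos: "v $ 2 > 0" "w $ 2 > 0" using v w by (auto simp: polar_domain_def)
  have c: "v $ 2 * cos (v $ 3) = w $ 2 * cos (w $ 3)" "v $ 2 * sin (v $ 3) = w $ 2 * sin (w $ 3)"
    "v $ 2 * v $ 1 = w $ 2 * w $ 1"
    using interp_polar_plane(2-4)[OF D, of v] interp_polar_plane(2-4)[OF D, of w] eq by auto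
  have "(v $ 2)\<^sup>2 = (v $ 2 * cos (v $ 3))\<^sup>2 + (v $ 2 * sin (v $ 3))\<^sup>2"
    by (simp add: power_mult_distrib distrib_left[symmetric])
  also have "\<dots> = (w $ 2)\<^sup>2"
    unfolding c by (simp add: power_mult_distrib distrib_left[symmetric])
  finally have 2: "v $ 2 = w $ 2" using pos by (simp add: power2_eq_iff)
  then have 1: "v $ 1 = w $ 1" and "cos (v $ 3) = cos (w $ 3)" "sin (v $ 3) = sin (w $ 3)"
    using c pos by auto
  then obtain k :: int where k: "v $ 3 = w $ 3 + 2 * pi * of_int k"
    using sin_cos_eq_iff by metis
  have "\<bar>v $ 3 - w $ 3\<bar> < 2 * pi" using v w by (auto simp: polar_domain_def)
  then have "k = 0" using k pi_gt_zero by (simp add: abs_mult)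
  then show "v = w" using 1 2 k by (simp add: vec_eq_iff forall_3)
qed

text \<open>
  A nonconstant polynomial has a positive amplitude \<open>\<rho>\<close>. If the first two values differ, it is
  certainly nonconstant; the excluded set is a hyperplane.
\<close>

lemma polar_plane_surj:
  assumes b: "balanced b"
    and u: "\<And>i. u $ i \<ge> 0" and ne: "u $ 1 \<noteq> u $ 2"
  shows "u \<in> polar_plane b ` polar_domain b"
proof -
  have D: "interp_det b > 0" using interp_det_pos[OF b] .
  define p q r where "p = interp_const b u" "q = interp_cos b u" "r = interp_sin b u"
  have u_eq: "u $ i = p + q * cos (b $ i) + r * sin (b $ i)" for i
    using interp_node[of b u i] D by (simp add: interp_def p_q_r_def)
  define \<rho> where "\<rho> = sqrt (q\<^sup>2 + r\<^sup>2)"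
  have "\<not> (q = 0 \<and> r = 0)" using ne u_eq by auto
  then have pos: "\<rho> > 0" unfolding \<rho>_def real_sqrt_gt_0_iff sum_power2_gt_zero_iff by blast
  have "(- q / \<rho>)\<^sup>2 + (- r / \<rho>)\<^sup>2 = 1"
  proof -
    have "q\<^sup>2 + r\<^sup>2 = \<rho>\<^sup>2" by (simp add: \<rho>_def)
    then show ?thesis using pos by (simp add: power_divide add_divide_distrib[symmetric])
  qed
  then obtain t where t: "- q / \<rho> = cos t" "- r / \<rho> = sin t"
    using sincos_total_2pi by metis
  \<comment> \<open>The representative of the direction \<open>t\<close> in the prescribed half-open interval.\<close>
  define \<psi> where "\<psi> = b $ 1 + (t - b $ 1) rmod (2 * pi)"
  have "\<psi> = t - 2 * pi * of_int \<lfloor>(t - b $ 1) / (2 * pi)\<rfloor>"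
    by (simp add: \<psi>_def rmod_def)
  then have "cos \<psi> = cos t" "sin \<psi> = sin t"
    by (simp_all add: cos_diff sin_diff cos_int_2pin sin_int_2pin)
  then have qr: "q = - \<rho> * cos \<psi>" "r = - \<rho> * sin \<psi>"
    using t pos by (auto simp: field_simps)
  define v :: "real ^ 3" where "v = vector [p / \<rho>, \<rho>, \<psi>]"
  have v: "v $ 1 = p / \<rho>" "v $ 2 = \<rho>" "v $ 3 = \<psi>" by (simp_all add: v_def)
  have uv: "polar_plane b v = u"
    using pos by (simp add: vec_eq_iff polar_plane_def v u_eq qr cos_diff field_simps)
  have "\<rho> * (p / \<rho> - cos (b $ i - \<psi>)) \<ge> 0" for i
    using u[of i] unfolding uv[symmetric] by (simp add: polar_plane_def v)
  then have "cos (b $ i - \<psi>) \<le> p / \<rho>" for i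
    using pos by (simp add: zero_le_mult_iff)
  moreover have "0 \<le> (t - b $ 1) rmod (2 * pi)" "(t - b $ 1) rmod (2 * pi) < 2 * pi"
    by (auto intro!: rmod_nonneg rmod_less)
  ultimately have "v \<in> polar_domain b"
    using pos by (auto simp: polar_domain_def v \<psi>_def)
  then show ?thesis using uv by blast
qed

lemma polar_plane_nonneg: "v \<in> polar_domain b \<Longrightarrow> polar_plane b v $ i \<ge> 0"
  by (simp add: polar_domain_def polar_plane_def)

definition polar_plane_deriv :: "real ^ 3 \<Rightarrow> real ^ 3 \<Rightarrow> real ^ 3 \<Rightarrow> real ^ 3" where
  "polar_plane_deriv b v h = (\<chi> i. h $ 2 * (v $ 1 - cos (b $ i - v $ 3))
      + v $ 2 * (h $ 1 - sin (b $ i - v $ 3) * h $ 3))"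

lemma has_derivative_polar_plane:
  "(polar_plane b has_derivative polar_plane_deriv b v) (at v within S)"
proof (subst has_derivative_componentwise_within, rule ballI)
  fix e :: "real ^ 3" assume "e \<in> Basis"
  then obtain i where e: "e = axis i 1" by (auto simp: Basis_vec_def)
  have nth: "((\<lambda>v::real^3. v $ k) has_derivative (\<lambda>h. h $ k)) (at v within S)" for k
    by (intro bounded_linear_imp_has_derivative bounded_linear_vec_nth)
  have "((\<lambda>v. b $ i - v $ 3) has_derivative (\<lambda>h. 0 - h $ 3)) (at v within S)"
    by (intro has_derivative_diff has_derivative_const nth)
  note has_derivative_mult[OF nth[of 2] has_derivative_diff[OF nth[of 1] has_derivative_cos[OF this]]]
  then show "((\<lambda>v. polar_plane b v \<bullet> e) has_derivative (\<lambda>h. polar_plane_deriv b v h \<bullet> e)) (at v within S)"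
    by (simp add: e inner_axis polar_plane_def polar_plane_deriv_def algebra_simps)
qed

text \<open>
  The columns of the Jacobian matrix are \<open>\<rho>\<close>, \<open>q - cos (b\<^sub>i - \<psi>)\<close> and \<open>- \<rho> sin (b\<^sub>i - \<psi>)\<close>.
  Up to the factor \<open>\<rho>\<^sup>2\<close> this is the interpolation determinant of the rotated triple, and that
  determinant depends only on differences of angles.
\<close>

lemma det_polar_plane_deriv:
  "det (matrix (polar_plane_deriv b v)) = (v $ 2)\<^sup>2 * interp_det b"
proof -
  have "matrix (polar_plane_deriv b v) $ i $ 1 = v $ 2"
    "matrix (polar_plane_deriv b v) $ i $ 2 = v $ 1 - cos (b $ i - v $ 3)"
    "matrix (polar_plane_deriv b v) $ i $ 3 = - v $ 2 * sin (b $ i - v $ 3)" for i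
    by (simp_all add: matrix_def polar_plane_deriv_def axis_def)
  note cols = this
  have "det (matrix (polar_plane_deriv b v)) = (v $ 2)\<^sup>2 *
     (cos (b$2 - v$3) * sin (b$3 - v$3) - sin (b$2 - v$3) * cos (b$3 - v$3)
     + (cos (b$3 - v$3) * sin (b$1 - v$3) - sin (b$3 - v$3) * cos (b$1 - v$3))
     + (cos (b$1 - v$3) * sin (b$2 - v$3) - sin (b$1 - v$3) * cos (b$2 - v$3)))"
    unfolding det_3 cols by (simp add: power2_eq_square algebra_simps)
  moreover have "cos (x - t) * sin (y - t) - sin (x - t) * cos (y - t) = sin (y - x)" for x y t :: real
    using sin_diff[of "y - t" "x - t"] by (simp add: algebra_simps)
  ultimately show ?thesis by (simp add: interp_det_eq)
qed

section \<open>Wall areas and admissible directions\<close>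

lemma unit_wall_area_ge_1:
  assumes "q \<ge> 1"
  shows "unit_wall_area q = 2 * pi * q"
proof -
  have "max 0 (q - cos x) = q - cos x" for x
    using order_trans[OF cos_le_one[of x] assms] by (simp add: max_def)
  moreover have "((\<lambda>x. q - cos x) has_integral (q * (2 * pi) - sin (2 * pi)) - (q * 0 - sin 0)) {0..2 * pi}"
    by (intro fundamental_theorem_of_calculus)
      (auto intro!: derivative_eq_intros simp: has_real_derivative_iff_has_vector_derivative[symmetric])
  ultimately show ?thesis unfolding unit_wall_area_def by (simp add: integral_unique mult.commute)
qed

text \<open>
  The function \<open>cos k - cos x\<close> is positive exactly for \<open>k < x < 2\<pi> - k\<close>, and there its
  integral is elementary.
\<close>

lemma unit_wall_area_cos:
  assumes k: "0 \<le> k" "k \<le> pi"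
  shows "unit_wall_area (cos k) = 2 * ((pi - k) * cos k + sin k)"
proof -
  let ?h = "\<lambda>x. max 0 (cos k - cos x)"
  have "(?h has_integral 0) {0..k}"
  proof (rule has_integral_eq)
    show "((\<lambda>_. 0) has_integral 0) {0..k}" by simp
    show "0 = ?h x" if "x \<in> {0..k}" for x
      using that k cos_monotone_0_pi_le[of x k] by auto
  qed
  moreover have "(?h has_integral ((cos k * (2 * pi - k) - sin (2 * pi - k)) - (cos k * k - sin k))) {k..2 * pi - k}"
  proof (rule has_integral_eq)
    show "((\<lambda>x. cos k - cos x) has_integral ((cos k * (2 * pi - k) - sin (2 * pi - k)) - (cos k * k - sin k))) {k..2 * pi - k}"
      using k by (intro fundamental_theorem_of_calculus)
        (auto intro!: derivative_eq_intros simp: has_real_derivative_iff_has_vector_derivative[symmetric])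
    show "cos k - cos x = ?h x" if x: "x \<in> {k..2 * pi - k}" for x
    proof (cases "x \<le> pi")
      case True
      then show ?thesis using x k cos_monotone_0_pi_le[of k x] by auto
    next
      case False
      then show ?thesis using x k cos_monotone_0_pi_le[of k "2 * pi - x"] by auto
    qed
  qed
  ultimately have 1: "(?h has_integral 0 + ((cos k * (2 * pi - k) - sin (2 * pi - k)) - (cos k * k - sin k))) {0..2 * pi - k}"
    using k by (intro has_integral_combine[of 0 k]) auto
  have "(?h has_integral 0) {2 * pi - k..2 * pi}"
  proof (rule has_integral_eq)
    show "((\<lambda>_. 0) has_integral 0) {2 * pi - k..2 * pi}" by simp
    show "0 = ?h x" if "x \<in> {2 * pi - k..2 * pi}" for x
      using that k cos_monotone_0_pi_le[of "2 * pi - x" k] by auto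
  qed
  then have "(?h has_integral 0 + ((cos k * (2 * pi - k) - sin (2 * pi - k)) - (cos k * k - sin k)) + 0) {0..2 * pi}"
    by (intro has_integral_combine[OF _ _ 1]) (use k in auto)
  then show ?thesis
    unfolding unit_wall_area_def by (simp add: integral_unique sin_diff algebra_simps)
qed

lemma unit_wall_area_term_pos:
  assumes "0 \<le> k" "k < pi / 2"
  shows "(pi - k) * cos k + sin k > 0"
proof -
  have "cos k > 0" using assms by (intro cos_gt_zero_pi) auto
  moreover have "sin k \<ge> 0" using assms by (intro sin_ge_zero) auto
  ultimately show ?thesis using assms by (intro add_pos_nonneg mult_pos_pos) auto
qed

lemma unit_wall_area_pos: assumes "q > 0" shows "unit_wall_area q > 0"
proof (cases "q \<ge> 1")
  case True
  then show ?thesis using assms by (simp add: unit_wall_area_ge_1)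
next
  case False
  then have k: "cos (arccos q) = q" "0 \<le> arccos q" "arccos q < pi / 2"
    using assms arccos_less_mono[of q 0] by (auto intro: cos_arccos arccos_lbound)
  then show ?thesis
    using unit_wall_area_cos[of "arccos q"] unit_wall_area_term_pos[of "arccos q"] pi_gt_zero by simp
qed

lemma nn_integral_power2_exp:
  assumes h: "h > 0"
  shows "(\<integral>\<^sup>+x. ennreal (x\<^sup>2 * exp (- (x * h))) * indicator {0<..} x \<partial>lborel) = ennreal (2 / h ^ 3)"
proof -
  have "ennreal 2 = (\<integral>\<^sup>+x. ennreal (x\<^sup>2 * exp (- x)) * indicator {0 ..} x \<partial>lborel)"
    using nn_intergal_power_times_exp_Ici[of 2] by (simp add: numeral_2_eq_2)
  also have "\<dots> = ennreal h * (\<integral>\<^sup>+x. ennreal ((h * x)\<^sup>2 * exp (- (h * x))) * indicator {0 ..} (h * x) \<partial>lborel)"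
    using h by (subst nn_integral_real_affine[where c=h and t=0]) auto
  also have "(\<integral>\<^sup>+x. ennreal ((h * x)\<^sup>2 * exp (- (h * x))) * indicator {0 ..} (h * x) \<partial>lborel)
     = (\<integral>\<^sup>+x. ennreal (h\<^sup>2) * (ennreal (x\<^sup>2 * exp (- (x * h))) * indicator {0<..} x) \<partial>lborel)"
  proof (intro nn_integral_cong)
    fix x :: real
    consider "x < 0" | "x = 0" | "x > 0" by linarith
    then show "ennreal ((h * x)\<^sup>2 * exp (- (h * x))) * indicator {0 ..} (h * x)
      = ennreal (h\<^sup>2) * (ennreal (x\<^sup>2 * exp (- (x * h))) * indicator {0<..} x)"
    proof cases
      case 1
      then have "h * x < 0" using h by (simp add: mult_pos_neg)
      with 1 show ?thesis by simp
    next
      case 3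
      then have "h * x \<ge> 0" using h by simp
      with 3 show ?thesis
        by (simp add: ennreal_mult[symmetric] power_mult_distrib mult.assoc mult.commute[of x h])
    qed simp
  qed
  also have "\<dots> = ennreal (h\<^sup>2) * (\<integral>\<^sup>+x. ennreal (x\<^sup>2 * exp (- (x * h))) * indicator {0<..} x \<partial>lborel)"
    by (rule nn_integral_cmult) measurable
  finally have "ennreal 2 = ennreal (h ^ 3) * (\<integral>\<^sup>+x. ennreal (x\<^sup>2 * exp (- (x * h))) * indicator {0<..} x \<partial>lborel)"
    (is "_ = _ * ?I")
    using h by (simp add: mult.assoc[symmetric] ennreal_mult[symmetric] power3_eq_cube power2_eq_square)
  then have "ennreal (1 / h ^ 3) * ennreal 2 = ennreal (1 / h ^ 3) * ennreal (h ^ 3) * ?I"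
    by (simp add: mult.assoc)
  also have "ennreal (1 / h ^ 3) * ennreal (h ^ 3) = 1"
    using h by (subst ennreal_mult[symmetric]) auto
  finally show ?thesis
    using h by (simp add: ennreal_mult[symmetric] del: ennreal_numeral)
qed

text \<open>
  The \<open>i\<close>-th entry is the arc opposite to the \<open>i\<close>-th point, in agreement with the numbering of
  \<open>vartheta\<close>.
\<close>

definition arc_lengths :: "real ^ 3 \<Rightarrow> real ^ 3" where
  "arc_lengths b = vector [b $ 3 - b $ 2, b $ 1 - b $ 3 + 2 * pi, b $ 2 - b $ 1]"

lemma arc_lengths_simps [simp]: "arc_lengths b $ 1 = b $ 3 - b $ 2" "arc_lengths b $ 2 = b $ 1 - b $ 3 + 2 * pi" "arc_lengths b $ 3 = b $ 2 - b $ 1"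
  by (simp_all add: arc_lengths_def)

lemma cos_le_cos_iff:
  assumes "0 \<le> k" "k \<le> pi" "\<bar>x\<bar> \<le> pi"
  shows "cos x \<le> cos k \<longleftrightarrow> k \<le> \<bar>x\<bar>"
  using cos_mono_le_eq[of "\<bar>x\<bar>" k] assms by simp

lemma cos_le_cos_far:
  assumes "0 \<le> k" "k \<le> x" "x \<le> 2 * pi - k"
  shows "cos x \<le> cos k"
proof (cases "x \<le> pi")
  case True
  then show ?thesis using assms by (intro cos_monotone_0_pi_le) auto
next
  case False
  then have "cos (2 * pi - x) \<le> cos k" using assms by (intro cos_monotone_0_pi_le) auto
  then show ?thesis by (simp add: cos_diff)
qed

text \<open>
  The cosine of an angular distance is at most \<open>cos k\<close> if and only if the distance is at least
  \<open>k\<close>. For \<open>\<psi>\<close> in the arc from \<open>x\<close> to \<open>y\<close> the third point \<open>z\<close> is at least as far away as one of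
  the endpoints, so it imposes no condition.
\<close>

lemma admissible_in_arc_iff:
  assumes k: "0 < k" "k < pi / 2" and xy: "x < y" "y < x + pi" and z: "y < z" "z < x + 2 * pi"
    and \<psi>: "x \<le> \<psi>" "\<psi> < y"
  shows "cos (x - \<psi>) \<le> cos k \<and> cos (y - \<psi>) \<le> cos k \<and> cos (z - \<psi>) \<le> cos k \<longleftrightarrow> x + k \<le> \<psi> \<and> \<psi> \<le> y - k"
proof -
  have "cos (x - \<psi>) \<le> cos k \<longleftrightarrow> x + k \<le> \<psi>"
    using assms by (subst cos_le_cos_iff) auto
  moreover have "cos (y - \<psi>) \<le> cos k \<longleftrightarrow> \<psi> \<le> y - k"
    using assms by (subst cos_le_cos_iff) auto
  moreover have "cos (z - \<psi>) \<le> cos k" if "x + k \<le> \<psi>" "\<psi> \<le> y - k"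
    using assms that by (intro cos_le_cos_far) auto
  ultimately show ?thesis by blast
qed

text \<open>
  Each of the three arcs contributes the interval of points at distance at least \<open>k\<close> from both
  of its endpoints.
\<close>

lemma emeasure_admissible_directions:
  assumes b: "balanced b" and k: "0 < k" "k < pi / 2"
  shows "emeasure lborel {\<psi>. b $ 1 \<le> \<psi> \<and> \<psi> < b $ 1 + 2 * pi \<and> (\<forall>i. cos (b $ i - \<psi>) \<le> cos k)}
     = (\<Sum>i\<in>UNIV. ennreal (arc_lengths b $ i - 2 * k))"
proof -
  let ?C = "\<lambda>\<psi>. \<forall>i. cos (b $ i - \<psi>) \<le> cos k"
  have bb: "b$1 < b$2" "b$2 < b$1 + pi" "b$2 < b$3" "b$3 < b$2 + pi" "b$3 < b$1 + 2 * pi" "b$1 + pi < b$3"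
    using b by (auto simp: balanced_def)
  have Icc: "emeasure lborel {x..y} = ennreal (y - x)" for x y :: real
    by (simp add: emeasure_lborel_Icc_eq ennreal_neg)
  have per: "cos (x + 2 * pi - \<psi>) = cos (x - \<psi>)" for x \<psi>
    using cos_periodic[of "x - \<psi>"] by (simp add: algebra_simps)
  have C: "?C \<psi> \<longleftrightarrow> cos (b$1 - \<psi>) \<le> cos k \<and> cos (b$2 - \<psi>) \<le> cos k \<and> cos (b$3 - \<psi>) \<le> cos k" for \<psi>
    by (simp add: forall_3)
  have 1: "?C \<psi> \<longleftrightarrow> \<psi> \<in> {b$1 + k..b$2 - k}" if "b$1 \<le> \<psi>" "\<psi> < b$2" for \<psi>
    using admissible_in_arc_iff[OF k, of "b$1" "b$2" "b$3" \<psi>] bb that by (simp add: C)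
  have 2: "?C \<psi> \<longleftrightarrow> \<psi> \<in> {b$2 + k..b$3 - k}" if "b$2 \<le> \<psi>" "\<psi> < b$3" for \<psi>
    using admissible_in_arc_iff[OF k, of "b$2" "b$3" "b$1 + 2 * pi" \<psi>] bb that
    unfolding per by (simp add: C conj_ac)
  have 3: "?C \<psi> \<longleftrightarrow> \<psi> \<in> {b$3 + k..b$1 + 2 * pi - k}" if "b$3 \<le> \<psi>" "\<psi> < b$1 + 2 * pi" for \<psi>
    using admissible_in_arc_iff[OF k, of "b$3" "b$1 + 2 * pi" "b$2 + 2 * pi" \<psi>] bb that
    unfolding per by (simp add: C conj_ac)
  have "{\<psi>. b $ 1 \<le> \<psi> \<and> \<psi> < b $ 1 + 2 * pi \<and> ?C \<psi>}
     = {b$1 + k..b$2 - k} \<union> ({b$2 + k..b$3 - k} \<union> {b$3 + k..b$1 + 2 * pi - k})" (is "?L = ?R")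
  proof (rule set_eqI)
    fix \<psi>
    consider "\<psi> < b$1" | "b$1 \<le> \<psi>" "\<psi> < b$2" | "b$2 \<le> \<psi>" "\<psi> < b$3" | "b$3 \<le> \<psi>" "\<psi> < b$1 + 2 * pi"
      | "b$1 + 2 * pi \<le> \<psi>" by linarith
    then show "\<psi> \<in> ?L \<longleftrightarrow> \<psi> \<in> ?R"
    proof cases
      case 2 with 1[of \<psi>] k bb show ?thesis by auto
    next
      case 3 with 2[of \<psi>] k bb show ?thesis by auto
    next
      case 4 with 3[of \<psi>] k bb show ?thesis by auto
    qed (use k bb in auto)
  qed
  also have "emeasure lborel ?R = emeasure lborel {b$1 + k..b$2 - k} +
      (emeasure lborel {b$2 + k..b$3 - k} + emeasure lborel {b$3 + k..b$1 + 2 * pi - k})"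
  proof -
    have "{b$1 + k..b$2 - k} \<inter> ({b$2 + k..b$3 - k} \<union> {b$3 + k..b$1 + 2 * pi - k}) = {}"
      "{b$2 + k..b$3 - k} \<inter> {b$3 + k..b$1 + 2 * pi - k} = {}"
      using k bb by auto
    then show ?thesis by (simp add: plus_emeasure)
  qed
  finally show ?thesis unfolding Icc by (simp add: sum_3 algebra_simps)
qed

section \<open>The exponential integral over the positive octant\<close>

text \<open>
  The functional \<open>G\<close> of the introduction, for the polynomial with values \<open>u\<close> at the angles \<open>b\<close>.
\<close>

definition wall_area :: "real ^ 3 \<Rightarrow> real ^ 3 \<Rightarrow> real" where
  "wall_area b u = integral {0..2 * pi} (\<lambda>x. max 0 (interp b u x))"

lemma borel_measurable_interp_coeffs [measurable]:
  "interp_const b \<in> borel_measurable borel" "interp_cos b \<in> borel_measurable borel"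
  "interp_sin b \<in> borel_measurable borel"
  unfolding interp_const_def interp_cos_def interp_sin_def divide_inverse
  by (intro borel_measurable_continuous_onI continuous_intros)+

lemma borel_measurable_wall_area [measurable]: "wall_area b \<in> borel_measurable borel"
proof -
  have "wall_area b u = (LINT x|lborel. indicator {0..2 * pi} x * max 0 (interp b u x))" for u
  proof -
    have "set_integrable lborel {0..2 * pi} (\<lambda>x. max 0 (interp b u x))"
      unfolding interp_def by (intro borel_integrable_atLeastAtMost' continuous_intros)
    from set_borel_integral_eq_integral(2)[OF this] show ?thesis
      by (simp add: wall_area_def set_lebesgue_integral_def)
  qed
  then have "wall_area b = (\<lambda>u. LINT x|lborel. indicator {0..2 * pi} x * max 0 (interp b u x))" by auto
  also have "\<dots> \<in> borel_measurable borel"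
    unfolding interp_def
    by (rule lborel.borel_measurable_lebesgue_integral) measurable
  finally show ?thesis .
qed

text \<open>
  The contribution of the planes with \<open>q \<ge> 1\<close>, which are nonnegative on the whole circle.
\<close>

lemma nn_integral_flat_part:
  "(\<integral>\<^sup>+q. ennreal (2 * pi) * ennreal (2 / (2 * pi * q) ^ 3) * indicator {1..} q \<partial>lborel) = ennreal (1 / (4 * pi\<^sup>2))"
proof -
  have "(\<integral>\<^sup>+q. ennreal (2 * pi) * ennreal (2 / (2 * pi * q) ^ 3) * indicator {1..} q \<partial>lborel)
    = (\<integral>\<^sup>+q. ennreal (1 / (2 * pi\<^sup>2 * q ^ 3)) * indicator {1..} q \<partial>lborel)"
    by (intro nn_integral_cong)
      (auto simp: indicator_def ennreal_mult[symmetric] power_mult_distrib power3_eq_cube power2_eq_square field_simps)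
  also have "\<dots> = ennreal (0 - - 1 / (4 * pi\<^sup>2 * 1\<^sup>2))"
  proof (rule nn_integral_FTC_atLeast[where F="\<lambda>q. - 1 / (4 * pi\<^sup>2 * q\<^sup>2)"])
    show "((\<lambda>q. - 1 / (4 * pi\<^sup>2 * q\<^sup>2)) \<longlongrightarrow> 0) at_top"
      by (intro tendsto_divide_0[OF tendsto_const] filterlim_at_top_imp_at_infinity
          filterlim_tendsto_pos_mult_at_top[OF tendsto_const] filterlim_pow_at_top filterlim_ident) auto
    fix q :: real assume q: "1 \<le> q"
    show "((\<lambda>q. - 1 / (4 * pi\<^sup>2 * q\<^sup>2)) has_real_derivative 1 / (2 * pi\<^sup>2 * q ^ 3)) (at q)"
      using q by (auto intro!: derivative_eq_intros simp: field_simps power2_eq_square power3_eq_cube)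
    show "0 \<le> 1 / (2 * pi\<^sup>2 * q ^ 3)" using q by simp
  qed measurable
  finally show ?thesis by simp
qed

text \<open>
  The contribution to the \<open>q\<close>-integral of the planes that are negative somewhere on an arc of
  length \<open>\<theta>\<close>. The denominator is \<open>unit_wall_area q\<close> in closed form, so that continuity in \<open>q\<close> is
  evident.
\<close>

definition arc_density :: "real \<Rightarrow> real \<Rightarrow> real" where
  "arc_density \<theta> q = (\<theta> - 2 * arccos q) * (2 / (2 * ((pi - arccos q) * q + sin (arccos q))) ^ 3)"

lemma arc_density_eq:
  assumes "0 < q" "q \<le> 1"
  shows "arc_density \<theta> q = (\<theta> - 2 * arccos q) * (2 / unit_wall_area q ^ 3)"
proof -
  have "unit_wall_area (cos (arccos q)) = 2 * ((pi - arccos q) * cos (arccos q) + sin (arccos q))"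
    using assms by (intro unit_wall_area_cos arccos_lbound arccos_ubound) auto
  then show ?thesis using assms by (simp add: arc_density_def)
qed

text \<open>
  Substituting \<open>q = cos \<phi>\<close> gives the integral that defines \<open>f_arc\<close>; the factor \<open>1/4\<close> comes from
  \<open>2 / 2\<^sup>3\<close>.
\<close>

lemma integral_arc_density:
  assumes \<theta>: "0 < \<theta>" "\<theta> < pi"
  shows "(arc_density \<theta> has_integral f_arc \<theta> / 4) {cos (\<theta> / 2)..1}"
proof -
  let ?E = "\<lambda>q. (pi - arccos q) * q + sin (arccos q)"
  have c: "0 < cos (\<theta> / 2)" using \<theta> by (intro cos_gt_zero_pi) auto
  have pos: "?E q > 0" if "q \<in> {cos (\<theta> / 2)..1}" for q
  proof -
    have q: "0 < q" "q \<le> 1" using that c by auto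
    then have "unit_wall_area (cos (arccos q)) = 2 * ((pi - arccos q) * cos (arccos q) + sin (arccos q))"
      by (intro unit_wall_area_cos arccos_lbound arccos_ubound) auto
    then show ?thesis using q unit_wall_area_pos[of q] by simp
  qed
  have cont: "continuous_on {cos (\<theta> / 2)..1} (arc_density \<theta>)"
    unfolding arc_density_def using c
    by (intro continuous_intros) (use pos in \<open>force+\<close>)
  have "((\<lambda>\<phi>. - sin \<phi> *\<^sub>R arc_density \<theta> (cos \<phi>)) has_integral
     (integral {cos 0..cos (\<theta> / 2)} (arc_density \<theta>) - integral {cos (\<theta> / 2)..cos 0} (arc_density \<theta>))) {0..\<theta> / 2}"
  proof (rule has_integral_substitution_general[where s="{}" and c="cos (\<theta> / 2)" and d=1])
    show "cos ` {0..\<theta> / 2} \<subseteq> {cos (\<theta> / 2)..1}"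
      using \<theta> by (auto intro!: cos_monotone_0_pi_le)
    show "(cos has_real_derivative - sin x) (at x within {0..\<theta> / 2})" for x
      by (auto intro!: derivative_eq_intros)
  qed (use \<theta> cont in \<open>auto intro!: continuous_intros\<close>)
  moreover have "integral {cos 0..cos (\<theta> / 2)} (arc_density \<theta>) = 0"
  proof (cases "cos (\<theta> / 2) = 1")
    case False
    then have "cos (\<theta> / 2) < 1" using cos_le_one[of "\<theta> / 2"] by linarith
    then show ?thesis by simp
  qed simp
  ultimately have hi: "((\<lambda>\<phi>. - 4 * (- sin \<phi> * arc_density \<theta> (cos \<phi>))) has_integral
     - 4 * (- integral {cos (\<theta> / 2)..1} (arc_density \<theta>))) {0..\<theta> / 2}"
    by (intro has_integral_mult_right) simp
  have eq: "- 4 * (- sin \<phi> * arc_density \<theta> (cos \<phi>)) =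
     (\<theta> - 2 * \<phi>) * sin \<phi> / ((pi - \<phi>) * cos \<phi> + sin \<phi>) ^ 3" if "\<phi> \<in> {0..\<theta> / 2}" for \<phi>
  proof -
    have "arccos (cos \<phi>) = \<phi>" using that \<theta> by (intro arccos_cos) auto
    moreover define E where "E = (pi - \<phi>) * cos \<phi> + sin \<phi>"
    moreover have "E > 0" unfolding E_def using that \<theta> by (intro unit_wall_area_term_pos) auto
    ultimately show ?thesis
      unfolding arc_density_def by (simp add: E_def[symmetric] power_mult_distrib)
  qed
  have "f_arc \<theta> = 4 * integral {cos (\<theta> / 2)..1} (arc_density \<theta>)"
    unfolding f_arc_def using has_integral_eq[OF eq hi] by (simp add: integral_unique)
  then show ?thesis
    using integrable_integral[OF integrable_continuous_real[OF cont]] by simp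
qed

lemma nn_integral_arc_part:
  assumes \<theta>: "0 < \<theta>" "\<theta> < pi"
  shows "(\<integral>\<^sup>+q. ennreal (\<theta> - 2 * arccos q) * ennreal (2 / unit_wall_area q ^ 3) * indicator {0<..<1} q \<partial>lborel)
     = ennreal (f_arc \<theta> / 4)" and "f_arc \<theta> \<ge> 0"
proof -
  have c: "0 < cos (\<theta> / 2)" using \<theta> by (intro cos_gt_zero_pi) auto
  have nn: "0 \<le> arc_density \<theta> q" if q: "q \<in> {cos (\<theta> / 2)..1}" for q
  proof -
    have "arccos q \<le> arccos (cos (\<theta> / 2))"
      using q c by (intro arccos_le_arccos) auto
    then have "arccos q \<le> \<theta> / 2" using \<theta> by (simp add: arccos_cos)
    then show ?thesis using q c unit_wall_area_pos[of q] by (subst arc_density_eq) auto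
  qed
  have "(\<integral>\<^sup>+q. ennreal (\<theta> - 2 * arccos q) * ennreal (2 / unit_wall_area q ^ 3) * indicator {0<..<1} q \<partial>lborel)
     = (\<integral>\<^sup>+q. ennreal (arc_density \<theta> q) * indicator {cos (\<theta> / 2)..1} q \<partial>lborel)"
  proof (rule nn_integral_cong_AE, rule AE_mp[OF AE_lborel_singleton[of 1]], intro AE_I2 impI)
    fix q :: real assume "q \<noteq> 1"
    then consider "q \<notin> {0<..<1}" "q \<notin> {cos (\<theta> / 2)..1}" | "0 < q" "q < cos (\<theta> / 2)" "q < 1"
      | "cos (\<theta> / 2) \<le> q" "0 < q" "q < 1"
      using c cos_le_one[of "\<theta> / 2"] by force
    then show "ennreal (\<theta> - 2 * arccos q) * ennreal (2 / unit_wall_area q ^ 3) * indicator {0<..<1} q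
       = ennreal (arc_density \<theta> q) * indicator {cos (\<theta> / 2)..1} q"
    proof cases
      case 2
      then have "arccos (cos (\<theta> / 2)) \<le> arccos q" by (intro arccos_le_arccos) auto
      then have "\<theta> - 2 * arccos q \<le> 0" using \<theta> by (simp add: arccos_cos)
      then show ?thesis using 2 by (simp add: ennreal_neg)
    next
      case 3
      then have "0 < 2 / unit_wall_area q ^ 3" using unit_wall_area_pos[of q] by simp
      then show ?thesis using 3
        unfolding arc_density_eq[OF \<open>0 < q\<close> less_imp_le[OF \<open>q < 1\<close>]] by (subst ennreal_mult'') auto
    qed simp
  qed
  also have "\<dots> = ennreal (f_arc \<theta> / 4)"
    by (rule nn_integral_has_integral_lebesgue'[OF nn integral_arc_density[OF \<theta>]])
  finally show "(\<integral>\<^sup>+q. ennreal (\<theta> - 2 * arccos q) * ennreal (2 / unit_wall_area q ^ 3) * indicator {0<..<1} q \<partial>lborel)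
     = ennreal (f_arc \<theta> / 4)" .
  have "0 \<le> f_arc \<theta> / 4" using has_integral_nonneg[OF integral_arc_density[OF \<theta>] nn] .
  then show "f_arc \<theta> \<ge> 0" by simp
qed

definition admissible_directions :: "real ^ 3 \<Rightarrow> real \<Rightarrow> real set" where
  "admissible_directions b q = {\<psi>. b $ 1 \<le> \<psi> \<and> \<psi> < b $ 1 + 2 * pi \<and> (\<forall>i. cos (b $ i - \<psi>) \<le> q)}"

text \<open>
  The origin is a convex combination, with positive weights, of the three points of the circle.
  Hence the three cosines have a vanishing combination with positive coefficients and cannot all
  be negative.
\<close>

lemma admissible_directions_neg:
  assumes b: "balanced b" and q: "q < 0"
  shows "admissible_directions b q = {}"
proof (rule equals0I)
  fix \<psi> assume "\<psi> \<in> admissible_directions b q"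
  then have "cos (b $ i - \<psi>) < 0" for i using q by (auto simp: admissible_directions_def intro: le_less_trans)
  then have "(\<Sum>i\<in>UNIV. sin (b $ (i + 2) - b $ (i + 1)) * cos (b $ i - \<psi>)) < 0"
    using sum_strict_mono[of "UNIV :: 3 set" "\<lambda>i. sin (b $ (i + 2) - b $ (i + 1)) * cos (b $ i - \<psi>)" "\<lambda>_. 0"]
      balanced_sin_pos[OF b] by (simp add: mult_pos_neg)
  moreover have "(\<Sum>i\<in>UNIV. sin (b $ (i + 2) - b $ (i + 1)) * cos (b $ i - \<psi>)) = 0"
    by (simp add: sum_3 sin_diff cos_diff algebra_simps)
  ultimately show False by simp
qed

lemma admissible_directions_ge_1:
  assumes "1 \<le> q"
  shows "admissible_directions b q = {b $ 1..<b $ 1 + 2 * pi}"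
  using order_trans[OF cos_le_one assms] by (auto simp: admissible_directions_def)

lemma sets_admissible_directions [measurable]: "admissible_directions b q \<in> sets borel"
  unfolding admissible_directions_def by measurable

lemma AE_emeasure_admissible_directions:
  assumes b: "balanced b"
  shows "AE q in lborel. emeasure lborel (admissible_directions b q) * ennreal (2 / unit_wall_area q ^ 3) =
    ennreal (2 * pi) * ennreal (2 / (2 * pi * q) ^ 3) * indicator {1..} q +
    (\<Sum>i\<in>UNIV. ennreal (arc_lengths b $ i - 2 * arccos q) * ennreal (2 / unit_wall_area q ^ 3) * indicator {0<..<1} q)"
proof (rule AE_mp[OF AE_lborel_singleton[of 0]], intro AE_I2 impI)
  fix q :: real assume "q \<noteq> 0"
  then consider "q < 0" | "0 < q" "q < 1" | "1 \<le> q" by linarith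
  then show "emeasure lborel (admissible_directions b q) * ennreal (2 / unit_wall_area q ^ 3) =
    ennreal (2 * pi) * ennreal (2 / (2 * pi * q) ^ 3) * indicator {1..} q +
    (\<Sum>i\<in>UNIV. ennreal (arc_lengths b $ i - 2 * arccos q) * ennreal (2 / unit_wall_area q ^ 3) * indicator {0<..<1} q)"
  proof cases
    case 1
    then show ?thesis by (simp add: admissible_directions_neg[OF b])
  next
    case 2
    then have k: "cos (arccos q) = q" "0 < arccos q" "arccos q < pi / 2"
      using arccos_less_mono[of q 0] arccos_less_mono[of 1 q] by auto
    have "emeasure lborel (admissible_directions b q) = (\<Sum>i\<in>UNIV. ennreal (arc_lengths b $ i - 2 * arccos q))"
      using emeasure_admissible_directions[OF b k(2,3)] by (simp add: admissible_directions_def k(1))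
    then show ?thesis using 2 by (simp add: sum_distrib_right)
  next
    case 3
    then show ?thesis by (simp add: admissible_directions_ge_1 unit_wall_area_ge_1)
  qed
qed

lemma borel_measurable_arc_part:
  "(\<lambda>q. ennreal (\<theta> - 2 * arccos q) * ennreal (2 / unit_wall_area q ^ 3) * indicator {0<..<1} q) \<in> borel_measurable borel"
proof -
  have "(\<lambda>q. indicator {0<..<1} q *\<^sub>R (\<theta> - 2 * arccos q)) \<in> borel_measurable borel"
    by (intro borel_measurable_continuous_on_indicator continuous_intros) auto
  moreover have "unit_wall_area \<in> borel_measurable borel"
    by (rule borel_measurable_mono[OF mono_unit_wall_area])
  ultimately have "(\<lambda>q. ennreal (indicator {0<..<1} q *\<^sub>R (\<theta> - 2 * arccos q)) * ennreal (2 / unit_wall_area q ^ 3)) \<in> borel_measurable borel"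
    by measurable
  also have "(\<lambda>q. ennreal (indicator {0<..<1} q *\<^sub>R (\<theta> - 2 * arccos q)) * ennreal (2 / unit_wall_area q ^ 3))
     = (\<lambda>q. ennreal (\<theta> - 2 * arccos q) * ennreal (2 / unit_wall_area q ^ 3) * indicator {0<..<1} q)"
    by (auto simp: indicator_def)
  finally show ?thesis .
qed

lemma balanced_arc_lengths: "balanced b \<Longrightarrow> 0 < arc_lengths b $ i \<and> arc_lengths b $ i < pi"
  using exhaust_3[of i] by (auto simp: balanced_def)

definition support_density :: "real ^ 3 \<Rightarrow> real" where
  "support_density \<theta> = sin (\<theta> $ 1 / 2) * sin (\<theta> $ 2 / 2) * sin (\<theta> $ 3 / 2) * (1 / pi\<^sup>2 + (\<Sum>i\<in>UNIV. f_arc (\<theta> $ i)))"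

text \<open>
  Twice the area of an inscribed triangle, expressed by its angles, which are half the opposite
  arcs.
\<close>

lemma interp_det_eq_half_sines:
  "interp_det b = 4 * (sin (arc_lengths b $ 1 / 2) * sin (arc_lengths b $ 2 / 2) * sin (arc_lengths b $ 3 / 2))"
proof -
  define s t where "s = arc_lengths b $ 1 / 2" and "t = arc_lengths b $ 3 / 2"
  have a: "b$3 - b$2 = 2 * s" "b$2 - b$1 = 2 * t" "b$1 - b$3 = - (2 * s + 2 * t)" "arc_lengths b $ 2 / 2 = pi - (s + t)"
    by (simp_all add: s_def t_def field_simps)
  have "sin (2 * s) + sin (2 * t) - sin (2 * s + 2 * t) = 4 * (sin s * sin (s + t) * sin t)"
  proof -
    have s: "sin s * sin s = 1 - cos s * cos s" and t: "sin t * sin t = 1 - cos t * cos t"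
      using sin_cos_squared_add[of s] sin_cos_squared_add[of t] by (simp_all add: power2_eq_square)
    show ?thesis
      unfolding sin_add sin_double cos_double power2_eq_square using s t by algebra
  qed
  then show ?thesis
    unfolding interp_det_eq a s_def[symmetric] t_def[symmetric] sin_minus sin_pi_minus by linarith
qed

text \<open>
  In polar coordinates the three integrations separate: over \<open>\<rho>\<close> for fixed \<open>(q, \<psi>)\<close>, then over
  \<open>\<psi>\<close>, which yields the length of the set of admissible directions, and finally over \<open>q\<close>.
\<close>

lemma nn_integral_polar:
  assumes b: "balanced b"
  shows "(\<integral>\<^sup>+v\<in>polar_domain b. ennreal (\<bar>det (matrix (polar_plane_deriv b v))\<bar> * exp (- wall_area b (polar_plane b v))) \<partial>lborel)
    = ennreal (support_density (arc_lengths b))"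
proof -
  have D: "interp_det b > 0" using interp_det_pos[OF b] .
  let ?F = "\<lambda>v. ennreal (\<bar>det (matrix (polar_plane_deriv b v))\<bar> * exp (- wall_area b (polar_plane b v))) * indicator (polar_domain b) v"
  let ?G = "\<lambda>v. ennreal (interp_det b) * ennreal ((v $ 2)\<^sup>2 * exp (- (v $ 2 * unit_wall_area (v $ 1)))) * indicator (polar_domain b) v"
  have F_eq: "?F v = ?G v" for v
  proof (cases "v \<in> polar_domain b")
    case True
    then have "v $ 2 > 0" by (simp add: polar_domain_def)
    then have "wall_area b (polar_plane b v) = v $ 2 * unit_wall_area (v $ 1)"
      unfolding wall_area_def using D by (simp add: interp_polar_plane integral_unit_wall_area_shift)
    then show ?thesis using D True
      by (simp add: det_polar_plane_deriv abs_mult ennreal_mult[symmetric] mult_ac)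
  qed simp
  have [measurable]: "unit_wall_area \<in> borel_measurable borel" by (rule borel_measurable_mono[OF mono_unit_wall_area])
  have [measurable]: "polar_domain b \<in> sets borel"
    unfolding polar_domain_def by measurable
  have "(\<integral>\<^sup>+v. ?F v \<partial>lborel) = (\<integral>\<^sup>+v. ?G v \<partial>lborel)" using F_eq by simp
  also have "\<dots> = (\<integral>\<^sup>+q. \<integral>\<^sup>+\<psi>. \<integral>\<^sup>+\<rho>. ?G (vector [q, \<rho>, \<psi>]) \<partial>lborel \<partial>lborel \<partial>lborel)"
    by (rule nn_integral_lborel_vec3) measurable
  also have "\<dots> = (\<integral>\<^sup>+q. ennreal (interp_det b) * (emeasure lborel (admissible_directions b q) * ennreal (2 / unit_wall_area q ^ 3)) \<partial>lborel)"
  proof (rule nn_integral_cong_AE, rule AE_mp[OF AE_lborel_singleton[of 0]], intro AE_I2 impI)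
    fix q :: real assume q: "q \<noteq> 0"
    have G: "?G (vector [q, \<rho>, \<psi>]) = ennreal (interp_det b) * indicator (admissible_directions b q) \<psi> *
        (ennreal (\<rho>\<^sup>2 * exp (- (\<rho> * unit_wall_area q))) * indicator {0<..} \<rho>)" for \<rho> \<psi>
      by (auto simp: indicator_def polar_domain_def admissible_directions_def)
    have "(\<integral>\<^sup>+\<psi>. \<integral>\<^sup>+\<rho>. ?G (vector [q, \<rho>, \<psi>]) \<partial>lborel \<partial>lborel)
      = (\<integral>\<^sup>+\<psi>. ennreal (interp_det b) * indicator (admissible_directions b q) \<psi> *
        (\<integral>\<^sup>+\<rho>. ennreal (\<rho>\<^sup>2 * exp (- (\<rho> * unit_wall_area q))) * indicator {0<..} \<rho> \<partial>lborel) \<partial>lborel)"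
      unfolding G by (intro nn_integral_cong nn_integral_cmult) measurable
    also have "\<dots> = (\<integral>\<^sup>+\<psi>. ennreal (interp_det b) * ennreal (2 / unit_wall_area q ^ 3) * indicator (admissible_directions b q) \<psi> \<partial>lborel)"
    proof (cases "q < 0")
      case True
      then show ?thesis by (simp add: admissible_directions_neg[OF b])
    next
      case False
      then have "unit_wall_area q > 0" using q unit_wall_area_pos by simp
      then show ?thesis unfolding nn_integral_power2_exp[OF \<open>unit_wall_area q > 0\<close>] by (simp only: mult_ac)
    qed
    also have "\<dots> = ennreal (interp_det b) * (emeasure lborel (admissible_directions b q) * ennreal (2 / unit_wall_area q ^ 3))"
      by (subst nn_integral_cmult_indicator) (auto simp: mult_ac)
    finally show "(\<integral>\<^sup>+\<psi>. \<integral>\<^sup>+\<rho>. ?G (vector [q, \<rho>, \<psi>]) \<partial>lborel \<partial>lborel) =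
      ennreal (interp_det b) * (emeasure lborel (admissible_directions b q) * ennreal (2 / unit_wall_area q ^ 3))" .
  qed
  also have "\<dots> = (\<integral>\<^sup>+q. ennreal (interp_det b) *
    (ennreal (2 * pi) * ennreal (2 / (2 * pi * q) ^ 3) * indicator {1..} q +
    (\<Sum>i\<in>UNIV. ennreal (arc_lengths b $ i - 2 * arccos q) * ennreal (2 / unit_wall_area q ^ 3) * indicator {0<..<1} q)) \<partial>lborel)"
    by (rule nn_integral_cong_AE, rule AE_mp[OF AE_emeasure_admissible_directions[OF b]]) (intro AE_I2 impI, simp only:)
  also have "\<dots> = ennreal (interp_det b) * (ennreal (1 / (4 * pi\<^sup>2)) + (\<Sum>i\<in>UNIV. ennreal (f_arc (arc_lengths b $ i) / 4)))"
  proof -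
    let ?A = "\<lambda>q. ennreal (2 * pi) * ennreal (2 / (2 * pi * q) ^ 3) * indicator {1..} q"
    let ?B = "\<lambda>i q. ennreal (arc_lengths b $ i - 2 * arccos q) * ennreal (2 / unit_wall_area q ^ 3) * indicator {0<..<1} q"
    have A: "?A \<in> borel_measurable lborel" by measurable
    have B: "?B i \<in> borel_measurable lborel" for i using borel_measurable_arc_part by simp
    have B': "(\<lambda>q. \<Sum>i\<in>UNIV. ?B i q) \<in> borel_measurable lborel"
      by (intro borel_measurable_sum B)
    have I: "(\<integral>\<^sup>+q. ?B i q \<partial>lborel) = ennreal (f_arc (arc_lengths b $ i) / 4)" for i
      using nn_integral_arc_part(1) balanced_arc_lengths[OF b] by blast
    have "(\<integral>\<^sup>+q. ennreal (interp_det b) * (?A q + (\<Sum>i\<in>UNIV. ?B i q)) \<partial>lborel)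
      = ennreal (interp_det b) * (\<integral>\<^sup>+q. ?A q + (\<Sum>i\<in>UNIV. ?B i q) \<partial>lborel)"
      by (rule nn_integral_cmult[OF borel_measurable_add[OF A B']])
    also have "(\<integral>\<^sup>+q. ?A q + (\<Sum>i\<in>UNIV. ?B i q) \<partial>lborel)
      = (\<integral>\<^sup>+q. ?A q \<partial>lborel) + (\<integral>\<^sup>+q. (\<Sum>i\<in>UNIV. ?B i q) \<partial>lborel)"
      by (rule nn_integral_add[OF A B'])
    also have "(\<integral>\<^sup>+q. (\<Sum>i\<in>UNIV. ?B i q) \<partial>lborel) = (\<Sum>i\<in>UNIV. \<integral>\<^sup>+q. ?B i q \<partial>lborel)"
      by (rule nn_integral_sum[OF B])
    finally show ?thesis unfolding I nn_integral_flat_part .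
  qed
  also have "\<dots> = ennreal (interp_det b * (1 / (4 * pi\<^sup>2) + (\<Sum>i\<in>UNIV. f_arc (arc_lengths b $ i) / 4)))"
    using D nn_integral_arc_part(2) balanced_arc_lengths[OF b]
    by (simp add: sum_ennreal ennreal_plus[symmetric] ennreal_mult sum_nonneg del: ennreal_plus)
  also have "interp_det b * (1 / (4 * pi\<^sup>2) + (\<Sum>i\<in>UNIV. f_arc (arc_lengths b $ i) / 4)) = support_density (arc_lengths b)"
    unfolding interp_det_eq_half_sines support_density_def sum_divide_distrib[symmetric] by (simp add: field_simps)
  finally show ?thesis .
qed

lemma support_density_nonneg:
  assumes b: "balanced b"
  shows "support_density (arc_lengths b) \<ge> 0"
proof -
  have s: "0 \<le> sin (arc_lengths b $ i / 2)" for i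
    using balanced_arc_lengths[OF b, of i] by (intro sin_ge_zero) auto
  have f: "0 \<le> f_arc (arc_lengths b $ i)" for i
    using nn_integral_arc_part(2) balanced_arc_lengths[OF b] by blast
  show ?thesis
    unfolding support_density_def by (intro mult_nonneg_nonneg add_nonneg_nonneg sum_nonneg s f) simp
qed

theorem nn_integral_support_density:
  assumes b: "balanced b"
  shows "(\<integral>\<^sup>+u\<in>{u. \<forall>i. 0 \<le> u $ i}. ennreal (exp (- wall_area b u)) \<partial>lborel) = ennreal (support_density (arc_lengths b))"
proof -
  have D: "interp_det b > 0" using interp_det_pos[OF b] .
  let ?P = "{u :: real ^ 3. \<forall>i. 0 \<le> u $ i}"
  have [measurable]: "polar_domain b \<in> sets borel"
    unfolding polar_domain_def by measurable
  have [measurable]: "?P \<in> sets borel" by measurable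
  have [measurable]: "polar_plane b \<in> borel_measurable borel"
    unfolding polar_plane_def by (intro borel_measurable_vec_lambda) measurable
  have "(\<integral>\<^sup>+u\<in>?P. ennreal (exp (- wall_area b u)) \<partial>lborel) = (\<integral>\<^sup>+u\<in>?P. ennreal (exp (- wall_area b u)) \<partial>lebesgue)"
    by (subst nn_integral_completion) auto
  also have "\<dots> = (\<integral>\<^sup>+u\<in>polar_plane b ` polar_domain b. ennreal (exp (- wall_area b u)) \<partial>lebesgue)"
  proof (rule nn_integral_cong_AE)
    \<comment> \<open>Off the hyperplane \<open>u\<^sub>1 = u\<^sub>2\<close> the parametrisation covers the octant.\<close>
    have "negligible {u :: real ^ 3. (axis 1 1 - axis 2 1) \<bullet> u = 0}"
      by (rule negligible_hyperplane) (simp add: axis_eq_axis)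
    moreover have "{u :: real ^ 3. (axis 1 1 - axis 2 1) \<bullet> u = 0} = {u. u $ 1 = u $ 2}"
      by (auto simp: inner_diff_left inner_axis')
    ultimately have "{u :: real ^ 3. u $ 1 = u $ 2} \<in> null_sets lebesgue"
      by (simp add: negligible_iff_null_sets)
    then have "AE u::real^3 in lebesgue. u $ 1 \<noteq> u $ 2"
      by (rule AE_I') auto
    then show "AE u in lebesgue. ennreal (exp (- wall_area b u)) * indicator ?P u =
       ennreal (exp (- wall_area b u)) * indicator (polar_plane b ` polar_domain b) u"
    proof (rule AE_mp, intro AE_I2 impI)
      fix u :: "real ^ 3" assume "u $ 1 \<noteq> u $ 2"
      then have "u \<in> ?P \<longleftrightarrow> u \<in> polar_plane b ` polar_domain b"
        using polar_plane_surj[OF b] polar_plane_nonneg by auto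
      then show "ennreal (exp (- wall_area b u)) * indicator ?P u =
       ennreal (exp (- wall_area b u)) * indicator (polar_plane b ` polar_domain b) u"
        by (simp only: indicator_def)
    qed
  qed
  also have "\<dots> = ennreal (support_density (arc_lengths b))"
  proof (rule nn_integral_change_of_variables)
    show "inj_on (polar_plane b) (polar_domain b)" using D by (intro inj_on_polar_plane) simp
    show "(polar_plane b has_derivative polar_plane_deriv b v) (at v within polar_domain b)" for v
      by (rule has_derivative_polar_plane)
    show "(\<lambda>v. \<bar>det (matrix (polar_plane_deriv b v))\<bar> * exp (- wall_area b (polar_plane b v))) \<in> borel_measurable borel"
      unfolding det_polar_plane_deriv by measurable
  qed (use nn_integral_polar[OF b] support_density_nonneg[OF b] in auto)
  finally show ?thesis .
qed

section \<open>From the product over the teeth to an exponential\<close>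

lemma exp_minus_bounds:
  fixes t :: real
  assumes "0 \<le> t"
  shows "\<bar>(1 - t) - exp (- t)\<bar> \<le> t\<^sup>2"
proof -
  have "exp t \<ge> 1 + t" by (rule exp_ge_add_one_self)
  then have "exp (- t) \<le> 1 / (1 + t)"
    using assms by (simp add: exp_minus field_simps)
  also have "\<dots> \<le> 1 - t + t\<^sup>2"
  proof -
    have "1 \<le> (1 - t + t\<^sup>2) * (1 + t)"
      using assms by (simp add: algebra_simps power2_eq_square)
    then show ?thesis using assms by (simp add: divide_le_eq)
  qed
  finally have "exp (- t) \<le> 1 - t + t\<^sup>2" .
  moreover have "1 - t \<le> exp (- t)" using exp_ge_add_one_self[of "- t"] by simp
  ultimately show ?thesis by simp
qed

lemma prod_one_minus_approx_exp:
  fixes t :: "'a \<Rightarrow> real"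
  assumes t: "\<And>j. j \<in> A \<Longrightarrow> 0 \<le> t j" "\<And>j. j \<in> A \<Longrightarrow> t j \<le> 1"
  shows "\<bar>(\<Prod>j\<in>A. 1 - t j) - exp (- (\<Sum>j\<in>A. t j))\<bar> \<le> (\<Sum>j\<in>A. (t j)\<^sup>2)"
proof (cases "finite A")
  case True
  have "\<bar>(\<Prod>j\<in>A. 1 - t j) - (\<Prod>j\<in>A. exp (- t j))\<bar> \<le> (\<Sum>j\<in>A. \<bar>(1 - t j) - exp (- t j)\<bar>)"
    using norm_prod_diff[of A "\<lambda>j. 1 - t j" "\<lambda>j. exp (- t j)"] t by (auto simp: abs_le_iff)
  also have "\<dots> \<le> (\<Sum>j\<in>A. (t j)\<^sup>2)" by (intro sum_mono exp_minus_bounds t)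
  finally show ?thesis using True by (simp add: exp_sum[symmetric] sum_negf)
qed simp

text \<open>
  On each of the \<open>N\<close> cells the integrand differs from its value at the right end by at most
  \<open>L p / N\<close>.
\<close>

lemma riemann_sum_lipschitz:
  fixes h :: "real \<Rightarrow> real"
  assumes L: "\<And>x y. \<bar>h x - h y\<bar> \<le> L * \<bar>x - y\<bar>" and p: "p \<ge> 0" and N: "N > 0"
  shows "\<bar>(\<Sum>j\<in>{1..N}. p / real N * h (p * real j / real N)) - integral {0..p} h\<bar> \<le> L * p\<^sup>2 / real N"
proof -
  have L0: "L \<ge> 0" using L[of 0 1] by simp
  have "L-lipschitz_on UNIV h" using L L0 by (auto simp: lipschitz_on_def dist_real_def)
  then have "continuous_on UNIV h" by (rule lipschitz_on_continuous_on)
  then have cont: "continuous_on S h" for S using continuous_on_subset by blast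
  have int: "h integrable_on {a..b}" for a b by (rule integrable_continuous_real[OF cont])
  define d where "d = p / real N"
  have d: "d \<ge> 0" using p by (simp add: d_def)
  have "\<bar>(\<Sum>j\<in>{1..m}. d * h (d * real j)) - integral {0..d * real m} h\<bar> \<le> real m * (L * d\<^sup>2)" for m
  proof (induction m)
    case (Suc m)
    let ?a = "d * real m" and ?b = "d * real (Suc m)"
    have ab: "0 \<le> ?a" "?a \<le> ?b" "?b - ?a = d" using d by (auto simp: algebra_simps)
    have split: "integral {0..?b} h = integral {0..?a} h + integral {?a..?b} h"
      using Henstock_Kurzweil_Integration.integral_combine[where a=0 and c="?a" and b="?b" and f=h] ab int by simp
    have "((\<lambda>x. h ?b - h x) has_integral (d * h ?b - integral {?a..?b} h)) {?a..?b}"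
      using has_integral_diff[OF has_integral_const_real[of "h ?b" ?a ?b] integrable_integral[OF int]] ab by simp
    moreover have "norm (h ?b - h x) \<le> L * d" if "x \<in> {?a..?b} - {}" for x
    proof -
      have "\<bar>h ?b - h x\<bar> \<le> L * \<bar>?b - x\<bar>" by (rule L)
      also have "\<dots> \<le> L * d" using that ab L0 by (intro mult_left_mono) auto
      finally show ?thesis by simp
    qed
    ultimately have "norm (d * h ?b - integral {?a..?b} h) \<le> (L * d) * measure lborel {?a..?b}"
      using L0 d by (intro has_integral_bound_real[where S="{}"]) auto
    then have "\<bar>d * h ?b - integral {?a..?b} h\<bar> \<le> L * d\<^sup>2"
      using ab by (simp add: power2_eq_square)
    then show ?case using Suc.IH unfolding split by (simp add: algebra_simps)
  qed simp
  from this[of N] show ?thesis using N by (simp add: d_def power2_eq_square)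
qed

text \<open>
  After multiplication by \<open>2 sin (\<pi>/N)\<close> both sums telescope.
\<close>

lemma sum_cos_sin_teeth:
  assumes N: "N \<ge> 2"
  shows "(\<Sum>j\<in>{1..N}. cos (tooth_angle N j)) = 0" and "(\<Sum>j\<in>{1..N}. sin (tooth_angle N j)) = 0"
proof -
  define a where "a = pi / real N"
  have a: "0 < a" "a < pi" using N by (auto simp: a_def divide_less_eq)
  then have sa: "sin a > 0" by (rule sin_gt_zero)
  have Na: "2 * real N * a = 2 * pi" using N by (simp add: a_def)
  have c: "(\<Sum>j\<in>{1..m}. 2 * sin a * cos (2 * real j * a)) = sin ((2 * real m + 1) * a) - sin a" for m
  proof (induction m)
    case (Suc m)
    have "2 * sin a * cos (2 * real (Suc m) * a) = sin ((2 * real (Suc m) + 1) * a) - sin ((2 * real m + 1) * a)"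
      using sin_diff_sin[of "(2 * real (Suc m) + 1) * a" "(2 * real m + 1) * a"]
      by (simp add: algebra_simps add_divide_distrib)
    with Suc show ?case by simp
  qed simp
  have s: "(\<Sum>j\<in>{1..m}. 2 * sin a * sin (2 * real j * a)) = cos a - cos ((2 * real m + 1) * a)" for m
  proof (induction m)
    case (Suc m)
    have "2 * sin a * sin (2 * real (Suc m) * a) = cos ((2 * real m + 1) * a) - cos ((2 * real (Suc m) + 1) * a)"
      using cos_diff_cos[of "(2 * real m + 1) * a" "(2 * real (Suc m) + 1) * a"]
      by (simp add: algebra_simps add_divide_distrib)
    with Suc show ?case by simp
  qed simp
  have t: "tooth_angle N j = 2 * real j * a" for j by (simp add: tooth_angle_def a_def)
  have "(2 * real N + 1) * a = a + 2 * pi" using Na by (simp add: distrib_right)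
  then have "sin ((2 * real N + 1) * a) = sin a" "cos ((2 * real N + 1) * a) = cos a"
    by simp_all
  then have "2 * sin a * (\<Sum>j\<in>{1..N}. cos (tooth_angle N j)) = 0" "2 * sin a * (\<Sum>j\<in>{1..N}. sin (tooth_angle N j)) = 0"
    using c[of N] s[of N] by (simp_all add: t sum_distrib_left)
  then show "(\<Sum>j\<in>{1..N}. cos (tooth_angle N j)) = 0" "(\<Sum>j\<in>{1..N}. sin (tooth_angle N j)) = 0"
    using sa by auto
qed

lemma sum_interp_teeth:
  assumes "N \<ge> 2"
  shows "(\<Sum>j\<in>{1..N}. interp b u (tooth_angle N j)) = real N * interp_const b u"
  using sum_cos_sin_teeth[OF assms]
  by (simp add: interp_def sum.distrib sum_distrib_left[symmetric])

lemma sum_interp_supporting_teeth: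
  assumes D: "interp_det b \<noteq> 0" and inj: "inj n"
    and nb: "\<And>i. tooth_base N (n i) = (cos (b $ i), sin (b $ i))"
  shows "(\<Sum>j\<in>range n. interp b u (tooth_angle N j)) = (\<Sum>i\<in>UNIV. u $ i)"
proof -
  have "interp b u (tooth_angle N (n i)) = interp b u (b $ i)" for i
    using nb[of i] by (simp add: interp_def tooth_base_def)
  then show ?thesis using interp_node[OF D] by (simp add: sum.reindex[OF inj])
qed

definition scaled_support_integrand :: "nat \<Rightarrow> (3 \<Rightarrow> nat) \<Rightarrow> real ^ 3 \<Rightarrow> real ^ 3 \<Rightarrow> ennreal" where
  "scaled_support_integrand N n b u = indicator {u. \<forall>i. 0 \<le> u $ i \<and> u $ i \<le> real N / (2 * pi)} u *
       (\<Prod>j\<in>{1..N} - range n. ennreal (max 0 (min 1 (1 - 2 * pi / real N * interp b u (tooth_angle N j)))))"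

text \<open>
  The majorant for dominated convergence. Each factor is at most \<open>exp (- s)\<close>, where \<open>s\<close> is
  \<open>2\<pi>/N\<close> times the interpolated value, of either sign. The sum of all interpolated values is
  \<open>N\<close> times the constant coefficient, whose weights are bounded below by \<open>\<delta>\<close>; the three
  supporting teeth that are missing from the product cost at most half of the exponent once
  \<open>N \<ge> 2/\<delta>\<close>.
\<close>

lemma scaled_support_integrand_le:
  assumes N: "N \<ge> 3" "1 / \<delta> * 2 \<le> real N" and \<delta>: "\<delta> > 0"
    and b: "balanced b" and inj: "inj n" and n: "\<And>i. n i \<in> {1..N}"
    and nb: "\<And>i. tooth_base N (n i) = (cos (b $ i), sin (b $ i))"
    and w: "\<And>i. \<delta> \<le> sin (b $ (i + 2) - b $ (i + 1)) / interp_det b"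
  shows "scaled_support_integrand N n b u \<le> indicator {u. \<forall>i. 0 \<le> u $ i} u * ennreal (exp (- (pi * \<delta> * (\<Sum>i\<in>UNIV. u $ i))))"
proof (cases "\<forall>i. 0 \<le> u $ i")
  case True
  let ?A = "{1..N} - range n" and ?c = "2 * pi / real N"
  let ?y = "\<lambda>j. interp b u (tooth_angle N j)"
  have D: "interp_det b \<noteq> 0" using interp_det_pos[OF b] by simp
  have fac: "max 0 (min 1 (1 - s)) \<le> exp (- s)" for s :: real
    using exp_ge_add_one_self[of "- s"] by (auto simp: min_def)
  have S: "0 \<le> (\<Sum>i\<in>UNIV. u $ i)" using True by (simp add: sum_nonneg)
  have "scaled_support_integrand N n b u \<le> (\<Prod>j\<in>?A. ennreal (max 0 (min 1 (1 - ?c * ?y j))))"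
    unfolding scaled_support_integrand_def by (simp add: indicator_def)
  also have "\<dots> = ennreal (\<Prod>j\<in>?A. max 0 (min 1 (1 - ?c * ?y j)))"
    by (rule prod_ennreal) simp
  also have "\<dots> \<le> ennreal (\<Prod>j\<in>?A. exp (- (?c * ?y j)))"
    by (intro ennreal_leI prod_mono conjI fac) auto
  also have "(\<Prod>j\<in>?A. exp (- (?c * ?y j))) = exp (- (?c * (\<Sum>j\<in>?A. ?y j)))"
    by (simp add: exp_sum[symmetric] sum_negf sum_distrib_left)
  also have "(\<Sum>j\<in>?A. ?y j) = real N * interp_const b u - (\<Sum>i\<in>UNIV. u $ i)"
    using n N sum_interp_supporting_teeth[OF D inj nb, of u] sum_interp_teeth[of N b u]
    by (subst sum_diff) auto
  also have "ennreal (exp (- (?c * (real N * interp_const b u - (\<Sum>i\<in>UNIV. u $ i)))))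
     \<le> ennreal (exp (- (pi * \<delta> * (\<Sum>i\<in>UNIV. u $ i))))"
  proof (intro ennreal_leI, subst exp_le_cancel_iff)
    have "\<delta> * (\<Sum>i\<in>UNIV. u $ i) \<le> (\<Sum>i\<in>UNIV. u $ i * (sin (b $ (i + 2) - b $ (i + 1)) / interp_det b))"
      unfolding sum_distrib_left
    proof (intro sum_mono)
      show "\<delta> * u $ i \<le> u $ i * (sin (b $ (i + 2) - b $ (i + 1)) / interp_det b)" for i
        by (subst mult.commute[of "u $ i"], rule mult_right_mono[OF w]) (use True in auto)
    qed
    also have "\<dots> = interp_const b u" by (simp add: interp_const_def sum_divide_distrib)
    finally have c: "\<delta> * (\<Sum>i\<in>UNIV. u $ i) \<le> interp_const b u" .
    have "?c \<le> pi * \<delta>" using N \<delta> by (simp add: field_simps)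
    then have "?c * (\<Sum>i\<in>UNIV. u $ i) \<le> pi * \<delta> * (\<Sum>i\<in>UNIV. u $ i)" using S by (rule mult_right_mono)
    moreover have "2 * pi * (\<delta> * (\<Sum>i\<in>UNIV. u $ i)) \<le> 2 * pi * interp_const b u"
      using c by (intro mult_left_mono) auto
    moreover have "?c * (real N * interp_const b u - (\<Sum>i\<in>UNIV. u $ i)) = 2 * pi * interp_const b u - ?c * (\<Sum>i\<in>UNIV. u $ i)"
      using N by (simp add: right_diff_distrib)
    ultimately show "- (?c * (real N * interp_const b u - (\<Sum>i\<in>UNIV. u $ i))) \<le> - (pi * \<delta> * (\<Sum>i\<in>UNIV. u $ i))"
      by linarith
  qed
  finally show ?thesis using True by simp
next
  case False
  then have "scaled_support_integrand N n b u = 0" unfolding scaled_support_integrand_def by (auto simp: indicator_def)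
  then show ?thesis by simp
qed

lemma nn_integral_exp_orthant_finite:
  assumes k: "k > 0"
  shows "(\<integral>\<^sup>+(u::real^'n). indicator {u. \<forall>i. 0 \<le> u $ i} u * ennreal (exp (- (k * (\<Sum>i\<in>UNIV. u $ i)))) \<partial>lborel) < \<infinity>"
proof -
  interpret L: product_sigma_finite "\<lambda>_::'n. lborel :: real measure" ..
  have "(\<integral>\<^sup>+(u::real^'n). indicator {u. \<forall>i. 0 \<le> u $ i} u * ennreal (exp (- (k * (\<Sum>i\<in>UNIV. u $ i)))) \<partial>lborel)
    = (\<integral>\<^sup>+f. indicator {u. \<forall>i. 0 \<le> u $ i} ((\<chi> i. f i) :: real^'n) * ennreal (exp (- (k * (\<Sum>i\<in>UNIV. f i)))) \<partial>(\<Pi>\<^sub>M i\<in>UNIV. lborel))"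
    by (subst nn_integral_lborel_vec) simp_all
  also have "\<dots> = (\<integral>\<^sup>+f. (\<Prod>i\<in>(UNIV::'n set). ennreal (exp (- (k * f i))) * indicator {0..} (f i)) \<partial>(\<Pi>\<^sub>M i\<in>UNIV. lborel))"
  proof (intro nn_integral_cong)
    fix f :: "'n \<Rightarrow> real"
    show "indicator {u. \<forall>i. 0 \<le> u $ i} ((\<chi> i. f i) :: real^'n) * ennreal (exp (- (k * (\<Sum>i\<in>UNIV. f i))))
      = (\<Prod>i\<in>(UNIV::'n set). ennreal (exp (- (k * f i))) * indicator {0..} (f i))"
    proof (cases "\<forall>i. 0 \<le> f i")
      case True
      then show ?thesis by (simp add: prod_ennreal exp_sum[symmetric] sum_negf sum_distrib_left)
    next
      case False
      then obtain i where "\<not> 0 \<le> f i" by blast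
      then have "(\<Prod>i\<in>(UNIV::'n set). ennreal (exp (- (k * f i))) * indicator {0..} (f i)) = 0"
        by (intro prod_zero bexI[of _ i]) auto
      moreover have "indicator {u. \<forall>i. 0 \<le> u $ i} ((\<chi> i. f i) :: real^'n) = (0 :: ennreal)"
        using False by simp
      ultimately show ?thesis by (simp only: mult_zero_left)
    qed
  qed
  also have "\<dots> = (\<Prod>i\<in>(UNIV::'n set). \<integral>\<^sup>+x. ennreal (exp (- (k * x))) * indicator {0..} x \<partial>lborel)"
    by (intro L.product_nn_integral_prod) auto
  also have "(\<integral>\<^sup>+x. ennreal (exp (- (k * x))) * indicator {0..} x \<partial>lborel) = ennreal (0 - (- exp (- (k * 0)) / k))"
  proof (rule nn_integral_FTC_atLeast)
    show "((\<lambda>x. - exp (- (k * x)) / k) \<longlongrightarrow> 0) at_top"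
    proof -
      have "filterlim (\<lambda>x. k * x) at_top at_top"
        using k by (intro filterlim_tendsto_pos_mult_at_top[OF tendsto_const] filterlim_ident)
      then have "((\<lambda>x. exp (- (k * x))) \<longlongrightarrow> 0) at_top"
        by (intro filterlim_compose[OF exp_at_bot]) (simp add: filterlim_uminus_at_bot)
      then show ?thesis using tendsto_divide[OF tendsto_minus tendsto_const[of k]] k by fastforce
    qed
    show "((\<lambda>x. - exp (- (k * x)) / k) has_real_derivative exp (- (k * x))) (at x)" for x
      using k by (auto intro!: derivative_eq_intros)
  qed auto
  finally show ?thesis using k by (simp add: prod_ennreal ennreal_power)
qed

lemma abs_cos_sin_diff_le:
  "\<bar>cos x - cos y\<bar> \<le> \<bar>x - y\<bar>" "\<bar>sin x - sin y\<bar> \<le> \<bar>x - y\<bar>" for x y :: real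
proof -
  have "norm (cos x - cos y) \<le> 1 * norm (x - y)"
    by (rule field_differentiable_bound[where S=UNIV and f'="\<lambda>x. - sin x"]) (auto intro!: derivative_eq_intros)
  then show "\<bar>cos x - cos y\<bar> \<le> \<bar>x - y\<bar>" by simp
  have "norm (sin x - sin y) \<le> 1 * norm (x - y)"
    by (rule field_differentiable_bound[where S=UNIV and f'="\<lambda>x. cos x"]) (auto intro!: derivative_eq_intros)
  then show "\<bar>sin x - sin y\<bar> \<le> \<bar>x - y\<bar>" by simp
qed

lemma abs_max_0_diff_le: "\<bar>max 0 x - max 0 y\<bar> \<le> \<bar>x - y\<bar>" for x y :: real
  by (auto simp: max_def)

lemma interp_lipschitz:
  "\<bar>max 0 (interp b u x) - max 0 (interp b u y)\<bar> \<le> (\<bar>interp_cos b u\<bar> + \<bar>interp_sin b u\<bar>) * \<bar>x - y\<bar>"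
proof -
  have "\<bar>max 0 (interp b u x) - max 0 (interp b u y)\<bar> \<le> \<bar>interp b u x - interp b u y\<bar>"
    by (rule abs_max_0_diff_le)
  also have "interp b u x - interp b u y = interp_cos b u * (cos x - cos y) + interp_sin b u * (sin x - sin y)"
    by (simp add: interp_def algebra_simps)
  also have "\<bar>\<dots>\<bar> \<le> \<bar>interp_cos b u\<bar> * \<bar>cos x - cos y\<bar> + \<bar>interp_sin b u\<bar> * \<bar>sin x - sin y\<bar>"
    by (rule order_trans[OF abs_triangle_ineq]) (simp add: abs_mult)
  also have "\<dots> \<le> \<bar>interp_cos b u\<bar> * \<bar>x - y\<bar> + \<bar>interp_sin b u\<bar> * \<bar>x - y\<bar>"
    by (intro add_mono mult_left_mono abs_cos_sin_diff_le) auto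
  finally show ?thesis by (simp add: algebra_simps)
qed

definition coeff_dist :: "real ^ 3 \<Rightarrow> real ^ 3 \<Rightarrow> real ^ 3 \<Rightarrow> real" where
  "coeff_dist b b' u = \<bar>interp_const b u - interp_const b' u\<bar> + \<bar>interp_cos b u - interp_cos b' u\<bar>
     + \<bar>interp_sin b u - interp_sin b' u\<bar>"

lemma abs_mult_le: "\<bar>c\<bar> \<le> 1 \<Longrightarrow> \<bar>a * c\<bar> \<le> \<bar>a\<bar>" for a c :: real
  using mult_left_mono[of "\<bar>c\<bar>" 1 "\<bar>a\<bar>"] by (simp add: abs_mult)

lemma interp_diff_le: "\<bar>max 0 (interp b u x) - max 0 (interp b' u x)\<bar> \<le> coeff_dist b b' u"
proof -
  have "\<bar>max 0 (interp b u x) - max 0 (interp b' u x)\<bar> \<le> \<bar>interp b u x - interp b' u x\<bar>"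
    by (rule abs_max_0_diff_le)
  also have "interp b u x - interp b' u x = (interp_const b u - interp_const b' u)
      + (interp_cos b u - interp_cos b' u) * cos x + (interp_sin b u - interp_sin b' u) * sin x"
    by (simp add: interp_def algebra_simps)
  also have "\<bar>\<dots>\<bar> \<le> coeff_dist b b' u"
    unfolding coeff_dist_def
    by (intro order_trans[OF abs_triangle_ineq] add_mono abs_mult_le abs_cos_le_one abs_sin_le_one order_refl)
  finally show ?thesis .
qed

lemma interp_bound: "\<bar>interp b u x\<bar> \<le> \<bar>interp_const b u\<bar> + \<bar>interp_cos b u\<bar> + \<bar>interp_sin b u\<bar>"
  unfolding interp_def
  by (intro order_trans[OF abs_triangle_ineq] add_mono abs_mult_le abs_cos_le_one abs_sin_le_one order_refl)

lemma tendsto_interp_coeffs: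
  assumes b: "b \<longlonglongrightarrow> \<beta>" and D: "interp_det \<beta> \<noteq> 0"
  shows "(\<lambda>N. interp_const (b N) u) \<longlonglongrightarrow> interp_const \<beta> u"
    "(\<lambda>N. interp_cos (b N) u) \<longlonglongrightarrow> interp_cos \<beta> u"
    "(\<lambda>N. interp_sin (b N) u) \<longlonglongrightarrow> interp_sin \<beta> u"
    "(\<lambda>N. sin (b N $ (i + 2) - b N $ (i + 1)) / interp_det (b N)) \<longlonglongrightarrow> sin (\<beta> $ (i + 2) - \<beta> $ (i + 1)) / interp_det \<beta>"
proof -
  have d: "(\<lambda>N. interp_det (b N)) \<longlonglongrightarrow> interp_det \<beta>"
    unfolding interp_det_def by (intro tendsto_intros b)
  show "(\<lambda>N. interp_const (b N) u) \<longlonglongrightarrow> interp_const \<beta> u"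
    "(\<lambda>N. interp_cos (b N) u) \<longlonglongrightarrow> interp_cos \<beta> u"
    "(\<lambda>N. interp_sin (b N) u) \<longlonglongrightarrow> interp_sin \<beta> u"
    "(\<lambda>N. sin (b N $ (i + 2) - b N $ (i + 1)) / interp_det (b N)) \<longlonglongrightarrow> sin (\<beta> $ (i + 2) - \<beta> $ (i + 1)) / interp_det \<beta>"
    unfolding interp_const_def interp_cos_def interp_sin_def
    by (intro tendsto_divide tendsto_intros b d D)+
qed

text \<open>
  All factors are \<open>1 - O(1/N)\<close>, so the product differs from the exponential of the negative sum by
  \<open>O(1/N)\<close>. That sum is a Riemann sum up to two small errors, one from the three omitted teeth and
  one from replacing the angles \<open>b N\<close> by their limits.
\<close>

lemma scaled_support_integrand_tendsto:
  assumes \<beta>: "interp_det \<beta> \<noteq> 0" and b: "b \<longlonglongrightarrow> \<beta>" and u: "\<And>i. 0 \<le> u $ i"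
  shows "(\<lambda>N. scaled_support_integrand N (n N) (b N) u) \<longlonglongrightarrow> ennreal (exp (- wall_area \<beta> u))"
proof -
  note lim = tendsto_interp_coeffs[OF b \<beta>]
  let ?h = "\<lambda>N j. max 0 (interp (b N) u (tooth_angle N j))"
  define t where "t N j = 2 * pi / real N * ?h N j" for N j
  let ?A = "\<lambda>N. {1..N} - range (n N)"
  \<comment> \<open>The summand \<open>1\<close> leaves room for the coefficients at \<open>b N\<close>, which are only close to those at \<open>\<beta>\<close>.\<close>
  define C where "C = \<bar>interp_const \<beta> u\<bar> + \<bar>interp_cos \<beta> u\<bar> + \<bar>interp_sin \<beta> u\<bar> + 1"
  have C0: "C \<ge> 0" by (simp add: C_def)
  have "(\<lambda>N. \<bar>interp_const (b N) u\<bar> + \<bar>interp_cos (b N) u\<bar> + \<bar>interp_sin (b N) u\<bar>) \<longlonglongrightarrow> C - 1"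
    unfolding C_def by (rule tendsto_eq_intros lim | simp)+
  then have evC: "\<forall>\<^sub>F N in sequentially. \<bar>interp_const (b N) u\<bar> + \<bar>interp_cos (b N) u\<bar> + \<bar>interp_sin (b N) u\<bar> < C"
    by (rule order_tendstoD) simp
  have ev_u: "\<forall>\<^sub>F N in sequentially. u $ i \<le> real N / (2 * pi)" for i
    using eventually_ge_at_top[of "nat \<lceil>2 * pi * u $ i\<rceil>"]
    by eventually_elim (simp add: nat_le_iff ceiling_le_iff field_simps)
  have ev: "\<forall>\<^sub>F N in sequentially. 0 < N \<and> 2 * pi * C \<le> real N \<and> (\<forall>i. u $ i \<le> real N / (2 * pi)) \<and>
      \<bar>interp_const (b N) u\<bar> + \<bar>interp_cos (b N) u\<bar> + \<bar>interp_sin (b N) u\<bar> < C"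
    using evC eventually_all_finite[OF ev_u] eventually_gt_at_top[of 0] eventually_ge_at_top[of "nat \<lceil>2 * pi * C\<rceil>"]
    by eventually_elim (auto simp: nat_le_iff ceiling_le_iff)
  define R where "R N = (\<Prod>j\<in>?A N. 1 - t N j)" for N
  define E where "E N = exp (- (\<Sum>j\<in>?A N. t N j))" for N
  have t_bounds: "\<forall>\<^sub>F N in sequentially. \<forall>j. 0 \<le> t N j \<and> t N j \<le> 2 * pi * C / real N \<and> t N j \<le> 1"
    using ev
  proof eventually_elim
    case (elim N)
    show ?case
    proof
      fix j
      have "?h N j \<le> C" using interp_bound[of "b N" u "tooth_angle N j"] elim C0 by auto
      then have "t N j \<le> 2 * pi / real N * C" unfolding t_def by (intro mult_left_mono) auto
      moreover have "2 * pi / real N * C \<le> 1" using elim by (simp add: divide_le_eq)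
      ultimately show "0 \<le> t N j \<and> t N j \<le> 2 * pi * C / real N \<and> t N j \<le> 1" by (simp add: t_def)
    qed
  qed
  have null: "(\<lambda>N. c / real N) \<longlonglongrightarrow> 0" for c :: real
    by (intro tendsto_divide_0[OF tendsto_const] filterlim_at_top_imp_at_infinity filterlim_real_sequentially)
  have RE: "(\<lambda>N. R N - E N) \<longlonglongrightarrow> 0"
  proof (rule Lim_null_comparison[OF _ null[of "(2 * pi * C)\<^sup>2"]])
    show "\<forall>\<^sub>F N in sequentially. norm (R N - E N) \<le> (2 * pi * C)\<^sup>2 / real N"
      using t_bounds ev
    proof eventually_elim
      case (elim N)
      have "norm (R N - E N) \<le> (\<Sum>j\<in>?A N. (t N j)\<^sup>2)"
        unfolding R_def E_def real_norm_def using elim by (intro prod_one_minus_approx_exp) auto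
      also have "\<dots> \<le> (\<Sum>j\<in>{1..N}. (t N j)\<^sup>2)" by (intro sum_mono2) auto
      also have "\<dots> \<le> (\<Sum>j\<in>{1..N}. (2 * pi * C / real N)\<^sup>2)"
        using elim by (intro sum_mono power_mono) auto
      also have "\<dots> = (2 * pi * C)\<^sup>2 / real N" using elim by (simp add: power2_eq_square)
      finally show ?case .
    qed
  qed
  have S: "(\<lambda>N. (\<Sum>j\<in>?A N. t N j) - wall_area \<beta> u) \<longlonglongrightarrow> 0"
  proof (rule Lim_null_comparison)
    let ?L = "\<bar>interp_cos \<beta> u\<bar> + \<bar>interp_sin \<beta> u\<bar>"
    show "\<forall>\<^sub>F N in sequentially. norm ((\<Sum>j\<in>?A N. t N j) - wall_area \<beta> u)
      \<le> 3 * (2 * pi * C) / real N + 2 * pi * coeff_dist (b N) \<beta> u + ?L * (2 * pi)\<^sup>2 / real N"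
      using t_bounds ev
    proof eventually_elim
      case (elim N)
      let ?s = "\<Sum>j\<in>{1..N}. 2 * pi / real N * max 0 (interp \<beta> u (tooth_angle N j))"
      have "(\<Sum>j\<in>{1..N}. t N j) = (\<Sum>j\<in>?A N. t N j) + (\<Sum>j\<in>{1..N} \<inter> range (n N). t N j)"
        by (subst sum.union_disjoint[symmetric]) (auto intro!: sum.cong)
      moreover have "(\<Sum>j\<in>{1..N} \<inter> range (n N). t N j) \<le> 3 * (2 * pi * C) / real N"
      proof -
        have card: "card ({1..N} \<inter> range (n N)) \<le> 3"
          using card_mono[of "range (n N)" "{1..N} \<inter> range (n N)"] card_image_le[of "UNIV :: 3 set" "n N"] by simp
        have "(\<Sum>j\<in>{1..N} \<inter> range (n N). t N j) \<le> real (card ({1..N} \<inter> range (n N))) * (2 * pi * C / real N)"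
          using elim by (intro sum_bounded_above) auto
        also have "\<dots> \<le> 3 * (2 * pi * C / real N)" using card C0 by (intro mult_right_mono) auto
        finally show ?thesis by simp
      qed
      moreover have "0 \<le> (\<Sum>j\<in>{1..N} \<inter> range (n N). t N j)" using elim by (intro sum_nonneg) auto
      moreover have "\<bar>(\<Sum>j\<in>{1..N}. t N j) - ?s\<bar> \<le> 2 * pi * coeff_dist (b N) \<beta> u"
      proof -
        have "\<bar>(\<Sum>j\<in>{1..N}. t N j) - ?s\<bar> \<le> (\<Sum>j\<in>{1..N}. \<bar>t N j - 2 * pi / real N * max 0 (interp \<beta> u (tooth_angle N j))\<bar>)"
          unfolding sum_subtractf[symmetric] by (rule sum_abs)
        also have "\<dots> \<le> (\<Sum>j\<in>{1..N}. 2 * pi / real N * coeff_dist (b N) \<beta> u)"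
          unfolding t_def right_diff_distrib[symmetric] abs_mult
          by (intro sum_mono mult_mono interp_diff_le) auto
        also have "\<dots> = 2 * pi * coeff_dist (b N) \<beta> u" using elim by simp
        finally show ?thesis .
      qed
      moreover have "\<bar>?s - wall_area \<beta> u\<bar> \<le> ?L * (2 * pi)\<^sup>2 / real N"
        unfolding wall_area_def tooth_angle_def
        using elim by (intro riemann_sum_lipschitz interp_lipschitz) auto
      ultimately show ?case unfolding real_norm_def by linarith
    qed
    have "(\<lambda>N. coeff_dist (b N) \<beta> u) \<longlonglongrightarrow> 0"
      unfolding coeff_dist_def by (rule tendsto_eq_intros lim | simp)+
    then show "(\<lambda>N. 3 * (2 * pi * C) / real N + 2 * pi * coeff_dist (b N) \<beta> u + ?L * (2 * pi)\<^sup>2 / real N) \<longlonglongrightarrow> 0"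
      by (auto intro!: tendsto_add_zero tendsto_mult_right_zero null)
  qed
  have "E \<longlonglongrightarrow> exp (- wall_area \<beta> u)"
    unfolding E_def using S by (intro tendsto_intros) (simp add: LIM_zero_iff)
  with RE have "R \<longlonglongrightarrow> exp (- wall_area \<beta> u)"
    using tendsto_add[OF RE] by fastforce
  then have "(\<lambda>N. ennreal (R N)) \<longlonglongrightarrow> ennreal (exp (- wall_area \<beta> u))"
    by (rule tendsto_ennrealI)
  moreover have "\<forall>\<^sub>F N in sequentially. ennreal (R N) = scaled_support_integrand N (n N) (b N) u"
    using t_bounds ev
  proof eventually_elim
    case (elim N)
    have "max 0 (min 1 (1 - 2 * pi / real N * interp (b N) u (tooth_angle N j))) = 1 - t N j" for j
    proof -
      let ?y = "interp (b N) u (tooth_angle N j)"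
      have c: "2 * pi / real N > 0" using elim by simp
      show ?thesis
      proof (cases "?y \<le> 0")
        case True
        then have "2 * pi / real N * ?y \<le> 0" using c by (intro mult_nonneg_nonpos) auto
        then show ?thesis using True by (simp add: t_def)
      next
        case False
        then have "t N j = 2 * pi / real N * ?y" by (simp add: t_def)
        moreover have "0 \<le> t N j" "t N j \<le> 1" using elim by auto
        ultimately show ?thesis by (simp only: max_def min_def) auto
      qed
    qed
    then show ?case
      using elim u by (simp add: scaled_support_integrand_def R_def prod_ennreal)
  qed
  ultimately show ?thesis by (rule Lim_transform_eventually)
qed

lemma borel_measurable_scaled_support_integrand [measurable]: "scaled_support_integrand N n b \<in> borel_measurable borel"
proof -
  show ?thesis unfolding scaled_support_integrand_def by measurable
qed

lemma scaled_support_prob_tendsto: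
  assumes comb: "random_comb M X" and \<beta>: "balanced \<beta>" and b: "b \<longlonglongrightarrow> \<beta>"
    and bal: "\<forall>\<^sub>F N in sequentially. balanced (b N)"
    and n: "\<forall>\<^sub>F N in sequentially. inj (n N) \<and> range (n N) \<subseteq> {1..N}"
    and nb: "\<forall>\<^sub>F N in sequentially. \<forall>i. tooth_base N (n N i) = (cos (b N $ i), sin (b N $ i))"
  shows "(\<lambda>N. (real N / (2 * pi)) ^ 3 * support_prob M X N (n N)) \<longlonglongrightarrow> support_density (arc_lengths \<beta>)"
proof -
  have D: "interp_det \<beta> > 0" using interp_det_pos[OF \<beta>] .
  note lim = tendsto_interp_coeffs[OF b less_imp_neq[OF D, symmetric]]
  \<comment> \<open>Half of the smallest limiting weight bounds the weights at \<open>b N\<close> from below for large \<open>N\<close>.\<close>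
  define \<delta> where "\<delta> = Min (range (\<lambda>i. sin (\<beta> $ (i + 2) - \<beta> $ (i + 1)) / interp_det \<beta>)) / 2"
  have \<delta>2: "2 * \<delta> \<le> sin (\<beta> $ (i + 2) - \<beta> $ (i + 1)) / interp_det \<beta>" for i
  proof -
    have "Min (range (\<lambda>i. sin (\<beta> $ (i + 2) - \<beta> $ (i + 1)) / interp_det \<beta>))
      \<le> sin (\<beta> $ (i + 2) - \<beta> $ (i + 1)) / interp_det \<beta>"
      by (rule Min_le) auto
    then show ?thesis by (simp add: \<delta>_def)
  qed
  have \<delta>: "\<delta> > 0"
    unfolding \<delta>_def using balanced_sin_pos[OF \<beta>] D by (simp add: Min_gr_iff)
  have "\<forall>\<^sub>F N in sequentially. \<delta> < sin (b N $ (i + 2) - b N $ (i + 1)) / interp_det (b N)" for i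
    using \<delta> \<delta>2[of i] by (intro order_tendstoD(1)[OF lim(4)]) simp
  then have w: "\<forall>\<^sub>F N in sequentially. \<forall>i. \<delta> < sin (b N $ (i + 2) - b N $ (i + 1)) / interp_det (b N)"
    by (rule eventually_all_finite)
  let ?good = "\<lambda>N. N \<ge> 3 \<and> 1 / \<delta> * 2 \<le> real N \<and> balanced (b N) \<and> inj (n N) \<and> (\<forall>i. n N i \<in> {1..N}) \<and>
    (\<forall>i. tooth_base N (n N i) = (cos (b N $ i), sin (b N $ i))) \<and>
    (\<forall>i. \<delta> < sin (b N $ (i + 2) - b N $ (i + 1)) / interp_det (b N))"
  have "\<forall>\<^sub>F N in sequentially. ?good N"
    using bal n nb w eventually_ge_at_top[of 3] eventually_ge_at_top[of "nat \<lceil>1 / \<delta> * 2\<rceil>"]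
    by eventually_elim (auto simp: nat_le_iff ceiling_le_iff image_subset_iff)
  then obtain N0 where good: "\<And>N. N \<ge> N0 \<Longrightarrow> ?good N" by (auto simp: eventually_sequentially)
  let ?P = "{u :: real ^ 3. \<forall>i. 0 \<le> u $ i}"
  let ?I = "\<lambda>N. \<integral>\<^sup>+u. scaled_support_integrand N (n N) (b N) u \<partial>lborel"
  have "(\<lambda>k. ?I (k + N0)) \<longlonglongrightarrow> (\<integral>\<^sup>+u. ennreal (exp (- wall_area \<beta> u)) * indicator ?P u \<partial>lborel)"
  proof (rule nn_integral_dominated_convergence)
    show "(\<integral>\<^sup>+u. indicator ?P u * ennreal (exp (- (pi * \<delta> * (\<Sum>i\<in>UNIV. u $ i)))) \<partial>lborel) < \<infinity>"
      by (rule nn_integral_exp_orthant_finite) (use \<delta> in auto)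
    show "AE u in lborel. scaled_support_integrand (k + N0) (n (k + N0)) (b (k + N0)) u
       \<le> indicator ?P u * ennreal (exp (- (pi * \<delta> * (\<Sum>i\<in>UNIV. u $ i))))" for k
      using good[of "k + N0"] \<delta> by (intro AE_I2 scaled_support_integrand_le) (auto intro: less_imp_le)
    show "AE u in lborel. (\<lambda>k. scaled_support_integrand (k + N0) (n (k + N0)) (b (k + N0)) u)
       \<longlonglongrightarrow> ennreal (exp (- wall_area \<beta> u)) * indicator ?P u"
    proof (intro AE_I2)
      fix u :: "real ^ 3"
      show "(\<lambda>k. scaled_support_integrand (k + N0) (n (k + N0)) (b (k + N0)) u)
         \<longlonglongrightarrow> ennreal (exp (- wall_area \<beta> u)) * indicator ?P u"
      proof (cases "u \<in> ?P")
        case True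
        then have "(\<lambda>N. scaled_support_integrand N (n N) (b N) u) \<longlonglongrightarrow> ennreal (exp (- wall_area \<beta> u))"
          using D b by (intro scaled_support_integrand_tendsto) auto
        then show ?thesis using True LIMSEQ_ignore_initial_segment[of _ _ N0] by force
      next
        case False
        then have "scaled_support_integrand N (n N) (b N) u = 0" for N
          by (auto simp: scaled_support_integrand_def indicator_def)
        then show ?thesis using False by simp
      qed
    qed
  qed measurable
  also have "(\<integral>\<^sup>+u. ennreal (exp (- wall_area \<beta> u)) * indicator ?P u \<partial>lborel) = ennreal (support_density (arc_lengths \<beta>))"
    by (rule nn_integral_support_density[OF \<beta>])
  also have "(\<lambda>k. ?I (k + N0)) = (\<lambda>k. ennreal ((real (k + N0) / (2 * pi)) ^ 3 * support_prob M X (k + N0) (n (k + N0))))"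
  proof
    fix k
    have g: "?good (k + N0)" by (rule good) simp
    then show "?I (k + N0) = ennreal ((real (k + N0) / (2 * pi)) ^ 3 * support_prob M X (k + N0) (n (k + N0)))"
      unfolding scaled_support_integrand_def by (intro scaled_support_prob[OF comb, symmetric]) auto
  qed
  finally have "(\<lambda>k. (real (k + N0) / (2 * pi)) ^ 3 * support_prob M X (k + N0) (n (k + N0))) \<longlonglongrightarrow> support_density (arc_lengths \<beta>)"
    by (rule tendsto_ennrealD) (auto simp: support_prob_def support_density_nonneg[OF \<beta>])
  then show ?thesis by (rule LIMSEQ_offset)
qed

section \<open>Angles modulo a full turn and the limit densities\<close>

lemma rcong_2pi_iff: "[x = y] (rmod (2 * pi)) \<longleftrightarrow> (\<exists>k. x = y + of_int k * (2 * pi))"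
proof -
  have "[x = y] (rmod (2 * pi)) \<longleftrightarrow> cis x = cis y" by (simp add: cis_eq_iff)
  also have "\<dots> \<longleftrightarrow> cis (x - y) = 1" by (simp add: cis_divide[symmetric])
  also have "\<dots> \<longleftrightarrow> (\<exists>k. x = y + of_int k * (2 * pi))" by (auto simp: cis_eq_1_iff algebra_simps)
  finally show ?thesis .
qed

lemma arc_gaps_iff:
  "arc_gaps \<phi> \<theta> \<longleftrightarrow> (\<forall>i. \<theta> $ i > 0) \<and> \<theta> $ 1 + \<theta> $ 2 + \<theta> $ 3 = 2 * pi \<and>
     [\<phi> $ 2 - \<phi> $ 1 = \<theta> $ 3] (rmod (2 * pi)) \<and> [\<phi> $ 3 - \<phi> $ 2 = \<theta> $ 1] (rmod (2 * pi)) \<and>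
     [\<phi> $ 1 - \<phi> $ 3 = \<theta> $ 2] (rmod (2 * pi))"
proof -
  have idx: "(1 :: 3) - 1 = 3" "(2 :: 3) - 1 = 1" "(3 :: 3) - 1 = 2"
    by (simp_all add: diff_eq_eq)
  show ?thesis unfolding arc_gaps_def sum_3 forall_3[of "\<lambda>i. [_ i = _ i] (rmod _)"] idx three_add_simps by auto
qed

lemma arc_gaps_less_2pi:
  assumes "arc_gaps \<phi> \<theta>"
  shows "0 < \<theta> $ i" "\<theta> $ i < 2 * pi"
proof -
  show "0 < \<theta> $ i" using assms by (simp add: arc_gaps_def)
  have "\<theta> $ 1 > 0" "\<theta> $ 2 > 0" "\<theta> $ 3 > 0" "\<theta> $ 1 + \<theta> $ 2 + \<theta> $ 3 = 2 * pi"
    using assms by (auto simp: arc_gaps_iff)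
  then show "\<theta> $ i < 2 * pi" using exhaust_3[of i] by auto
qed

lemma rcong_2pi_unique:
  assumes "[x = y] (rmod (2 * pi))" "\<bar>x - y\<bar> < 2 * pi"
  shows "x = y"
proof -
  obtain k where "x = y + of_int k * (2 * pi)" using assms(1) by (auto simp: rcong_2pi_iff)
  moreover from this have "k = 0" using assms(2) pi_gt_zero by (simp add: abs_mult)
  ultimately show ?thesis by simp
qed

text \<open>
  Arc lengths lie strictly between \<open>0\<close> and \<open>2\<pi>\<close>, so they are determined by their residues.
\<close>

lemma arc_gaps_unique:
  assumes "arc_gaps \<phi> \<theta>" "arc_gaps \<phi> \<theta>'"
  shows "\<theta> = \<theta>'"
proof -
  have "[\<theta> $ i = \<theta>' $ i] (rmod (2 * pi))" for i
    using assms exhaust_3[of i] unfolding arc_gaps_iff rcong_def by auto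
  moreover have "\<bar>\<theta> $ i - \<theta>' $ i\<bar> < 2 * pi" for i
    using arc_gaps_less_2pi[OF assms(1), of i] arc_gaps_less_2pi[OF assms(2), of i] by linarith
  ultimately show ?thesis by (simp add: vec_eq_iff rcong_2pi_unique)
qed

lemma vartheta_eq: "arc_gaps \<phi> \<theta> \<Longrightarrow> vartheta \<phi> = \<theta>"
  unfolding vartheta_def using arc_gaps_unique by (intro the_equality) auto

lemma S_set_iff: "\<phi> \<in> S_set \<longleftrightarrow> arc_gaps \<phi> (vartheta \<phi>) \<and> vartheta \<phi> \<in> T_set"
proof
  assume \<phi>: "\<phi> \<in> S_set"
  then obtain \<theta> where \<theta>: "arc_gaps \<phi> \<theta>" by (auto simp: S_set_def positively_oriented_def)
  have "\<forall>i. 0 < \<theta> $ i \<and> \<theta> $ i < pi"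
    using \<phi> unfolding S_set_def mem_Collect_eq vartheta_eq[OF \<theta>] by blast
  with \<theta> show "arc_gaps \<phi> (vartheta \<phi>) \<and> vartheta \<phi> \<in> T_set"
    unfolding vartheta_eq[OF \<theta>] T_set_def arc_gaps_def by blast
next
  assume "arc_gaps \<phi> (vartheta \<phi>) \<and> vartheta \<phi> \<in> T_set"
  then show "\<phi> \<in> S_set" unfolding S_set_def positively_oriented_def T_set_def by blast
qed

text \<open>
  Starting from the first angle, the arcs \<open>\<theta>\<^sub>3\<close> and \<open>\<theta>\<^sub>1\<close> lead to representatives of the other
  two.
\<close>

lemma balanced_representative:
  assumes "arc_gaps \<phi> \<theta>" "\<theta> \<in> T_set"
  obtains \<beta> where "balanced \<beta>" "arc_lengths \<beta> = \<theta>" "\<And>i. [\<phi> $ i = \<beta> $ i] (rmod (2 * pi))"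
proof
  let ?\<beta> = "vector [\<phi> $ 1, \<phi> $ 1 + \<theta> $ 3, \<phi> $ 1 + \<theta> $ 3 + \<theta> $ 1] :: real ^ 3"
  have \<theta>: "\<theta> $ 1 > 0" "\<theta> $ 2 > 0" "\<theta> $ 3 > 0" "\<theta> $ 1 < pi" "\<theta> $ 2 < pi" "\<theta> $ 3 < pi"
    "\<theta> $ 2 = 2 * pi - \<theta> $ 1 - \<theta> $ 3"
    using assms(2) by (auto simp: T_set_def sum_3)
  show "balanced ?\<beta>" using \<theta> unfolding balanced_def vector_3 by linarith
  show "arc_lengths ?\<beta> = \<theta>" using \<theta> by (simp add: arc_lengths_def vec_eq_iff forall_3)
  obtain k l where k: "\<phi> $ 2 - \<phi> $ 1 = \<theta> $ 3 + of_int k * (2 * pi)" and l: "\<phi> $ 3 - \<phi> $ 2 = \<theta> $ 1 + of_int l * (2 * pi)"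
    using assms(1) unfolding arc_gaps_iff rcong_2pi_iff by blast
  have "\<phi> $ 2 = ?\<beta> $ 2 + of_int k * (2 * pi)" "\<phi> $ 3 = ?\<beta> $ 3 + of_int (k + l) * (2 * pi)"
    using k l by (simp_all add: algebra_simps)
  then have "[\<phi> $ 2 = ?\<beta> $ 2] (rmod (2 * pi))" "[\<phi> $ 3 = ?\<beta> $ 3] (rmod (2 * pi))"
    unfolding rcong_2pi_iff by blast+
  moreover have "[\<phi> $ 1 = ?\<beta> $ 1] (rmod (2 * pi))" by simp
  ultimately show "[\<phi> $ i = ?\<beta> $ i] (rmod (2 * pi))" for i
    using exhaust_3[of i] by blast
qed

lemma open_balanced: "open {b. balanced b}"
  unfolding balanced_def by (intro open_Collect_conj open_Collect_less continuous_intros)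

text \<open>
  Convergence modulo \<open>2\<pi>\<close> is lifted to convergence of real representatives towards a balanced
  triple. Balanced triples form an open set, so the lifted triples are eventually balanced.
\<close>

lemma has_support_limit_density:
  assumes comb: "random_comb M X" and \<phi>: "\<phi> \<in> S_set"
  shows "has_support_limit M X \<phi> (support_density (vartheta \<phi>))"
  unfolding has_support_limit_def
proof (intro allI impI)
  fix n assume n: "teeth_tend_to n \<phi>"
  obtain \<beta> where \<beta>: "balanced \<beta>" "arc_lengths \<beta> = vartheta \<phi>" "\<And>i. [\<phi> $ i = \<beta> $ i] (rmod (2 * pi))"
    using \<phi> balanced_representative[of \<phi> "vartheta \<phi>"] by (auto simp: S_set_iff)
  have "\<exists>c. \<forall>i. c i \<longlonglongrightarrow> \<phi> $ i \<and> (\<forall>N. [tooth_angle N (n N i) = c i N] (rmod (2 * pi)))"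
    using n by (intro choice) (auto simp: teeth_tend_to_def tendsto_mod_2pi_def)
  then obtain c where c: "\<And>i. c i \<longlonglongrightarrow> \<phi> $ i" "\<And>i N. [tooth_angle N (n N i) = c i N] (rmod (2 * pi))"
    by blast
  \<comment> \<open>The correction \<open>\<beta> $ i - \<phi> $ i\<close> is a multiple of \<open>2\<pi>\<close>.\<close>
  define b where "b N = (\<chi> i. c i N + (\<beta> $ i - \<phi> $ i))" for N
  have b: "b \<longlonglongrightarrow> \<beta>"
  proof (rule vec_tendstoI)
    show "(\<lambda>N. b N $ i) \<longlonglongrightarrow> \<beta> $ i" for i
      using tendsto_add[OF c(1)[of i] tendsto_const[of "\<beta> $ i - \<phi> $ i"]] by (simp add: b_def)
  qed
  have cong: "[tooth_angle N (n N i) = b N $ i] (rmod (2 * pi))" for N i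
  proof -
    obtain k l where "tooth_angle N (n N i) = c i N + of_int k * (2 * pi)" "\<phi> $ i = \<beta> $ i + of_int l * (2 * pi)"
      using c(2)[of N i] \<beta>(3)[of i] unfolding rcong_2pi_iff by blast
    then have "tooth_angle N (n N i) = b N $ i + of_int (k + l) * (2 * pi)"
      by (simp add: b_def algebra_simps)
    then show ?thesis unfolding rcong_2pi_iff by blast
  qed
  have nb: "tooth_base N (n N i) = (cos (b N $ i), sin (b N $ i))" for N i
    using sin_rcong[OF cong] cos_rcong[OF cong] by (simp add: tooth_base_def)
  have "\<forall>\<^sub>F N in sequentially. balanced (b N)"
    using topological_tendstoD[OF b open_balanced] \<beta>(1) by simp
  moreover have "\<forall>\<^sub>F N in sequentially. inj (n N) \<and> range (n N) \<subseteq> {1..N}"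
    using n by (simp add: teeth_tend_to_def)
  ultimately show "(\<lambda>N. (real N / (2 * pi)) ^ 3 * support_prob M X N (n N)) \<longlonglongrightarrow> support_density (vartheta \<phi>)"
    using scaled_support_prob_tendsto[OF comb \<beta>(1) b] nb unfolding \<beta>(2) by simp
qed

text \<open>
  A limit along sequences of teeth is unique only because such sequences exist. Rounding
  \<open>N x / (2\<pi>)\<close> up gives a valid tooth number when the representative \<open>x\<close> is taken in
  \<open>(0, 2\<pi>]\<close>.
\<close>

lemma teeth_tend_to_exists:
  assumes \<phi>: "\<phi> \<in> S_set"
  shows "\<exists>n. teeth_tend_to n \<phi>"
proof -
  obtain \<beta> where \<beta>: "balanced \<beta>" "\<And>i. [\<phi> $ i = \<beta> $ i] (rmod (2 * pi))"
    using \<phi> balanced_representative[of \<phi> "vartheta \<phi>"] by (auto simp: S_set_iff)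
  \<comment> \<open>The representative of \<open>\<phi> $ i\<close> in \<open>(0, 2\<pi>]\<close>; since \<open>0\<close> is excluded, the rounded number is at least \<open>1\<close>.\<close>
  define x where "x i = 2 * pi - (- \<phi> $ i) rmod (2 * pi)" for i
  have x: "0 < x i" "x i \<le> 2 * pi" for i
    using rmod_less[of "2 * pi" "- \<phi> $ i"] rmod_nonneg[of "2 * pi" "- \<phi> $ i"] by (auto simp: x_def)
  have x\<phi>: "x i = \<phi> $ i + of_int (1 + \<lfloor>- \<phi> $ i / (2 * pi)\<rfloor>) * (2 * pi)" for i
    by (simp add: x_def rmod_def algebra_simps)
  have x_inj: "x i \<noteq> x j" if "i \<noteq> j" for i j
  proof
    assume eq: "x i = x j"
    obtain k l where "\<phi> $ i = \<beta> $ i + of_int k * (2 * pi)" "\<phi> $ j = \<beta> $ j + of_int l * (2 * pi)"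
      using \<beta>(2) unfolding rcong_2pi_iff by metis
    then have "\<beta> $ i = \<beta> $ j + of_int (l + (1 + \<lfloor>- \<phi> $ j / (2 * pi)\<rfloor>) - k - (1 + \<lfloor>- \<phi> $ i / (2 * pi)\<rfloor>)) * (2 * pi)"
      using x\<phi>[of i] x\<phi>[of j] eq by (simp add: algebra_simps)
    then have "[\<beta> $ i = \<beta> $ j] (rmod (2 * pi))" unfolding rcong_2pi_iff by blast
    moreover have "\<bar>\<beta> $ i - \<beta> $ j\<bar> < 2 * pi \<and> \<beta> $ i \<noteq> \<beta> $ j"
      using \<beta>(1) that exhaust_3[of i] exhaust_3[of j] by (auto simp: balanced_def)
    ultimately show False using rcong_2pi_unique by blast
  qed
  define n where "n N i = nat \<lceil>real N * x i / (2 * pi)\<rceil>" for N i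
  have n_ge: "real (n N i) \<ge> real N * x i / (2 * pi)" and n_le: "real (n N i) \<le> real N * x i / (2 * pi) + 1" for N i
  proof -
    have "0 \<le> real N * x i / (2 * pi)" using x[of i] by simp
    then show "real (n N i) \<ge> real N * x i / (2 * pi)" "real (n N i) \<le> real N * x i / (2 * pi) + 1"
      unfolding n_def by linarith+
  qed
  have range_n: "n N i \<in> {1..N}" if "N > 0" for N i
  proof -
    have "real N * x i / (2 * pi) > 0" using x[of i] that by simp
    then have "real (n N i) > 0" using n_ge[of N i] by linarith
    moreover
    have "real N * x i / (2 * pi) \<le> real N"
      using mult_left_mono[OF x(2)[of i], of "real N"] by (simp add: divide_le_eq)
    then have "\<lceil>real N * x i / (2 * pi)\<rceil> \<le> int N" by (simp add: ceiling_le_iff)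
    then have "n N i \<le> N" by (simp add: n_def nat_le_iff)
    ultimately show ?thesis by simp
  qed
  have lim: "(\<lambda>N. tooth_angle N (n N i)) \<longlonglongrightarrow> x i" for i
  proof (rule LIM_zero_cancel, rule Lim_null_comparison)
    show "\<forall>\<^sub>F N in sequentially. norm (tooth_angle N (n N i) - x i) \<le> 2 * pi / real N"
      using eventually_gt_at_top[of 0]
    proof eventually_elim
      case (elim N)
      have "2 * pi / real N * (real N * x i / (2 * pi)) \<le> 2 * pi / real N * real (n N i)"
        by (intro mult_left_mono n_ge) auto
      moreover have "2 * pi / real N * real (n N i) \<le> 2 * pi / real N * (real N * x i / (2 * pi) + 1)"
        by (intro mult_left_mono n_le) auto
      moreover have "2 * pi / real N * (real N * x i / (2 * pi)) = x i" using elim by simp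
      moreover have "2 * pi / real N * (real N * x i / (2 * pi) + 1) = x i + 2 * pi / real N"
        using elim by (simp add: distrib_left)
      ultimately show ?case by (simp add: tooth_angle_def abs_le_iff)
    qed
    show "(\<lambda>N. 2 * pi / real N) \<longlonglongrightarrow> 0"
      by (intro tendsto_divide_0[OF tendsto_const] filterlim_at_top_imp_at_infinity filterlim_real_sequentially)
  qed
  have "\<forall>\<^sub>F N in sequentially. i \<noteq> j \<longrightarrow> n N i \<noteq> n N j" for i j
  proof (cases "i = j")
    case False
    have "(\<lambda>N. tooth_angle N (n N i) - tooth_angle N (n N j)) \<longlonglongrightarrow> x i - x j"
      by (intro tendsto_diff lim)
    moreover have "x i - x j \<noteq> 0" using x_inj[OF False] by simp
    ultimately have "\<forall>\<^sub>F N in sequentially. tooth_angle N (n N i) - tooth_angle N (n N j) \<noteq> 0"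
      by (rule tendsto_imp_eventually_ne)
    then show ?thesis by eventually_elim auto
  qed simp
  then have "\<forall>\<^sub>F N in sequentially. \<forall>i j. i \<noteq> j \<longrightarrow> n N i \<noteq> n N j"
    by (intro eventually_all_finite)
  then have "\<forall>\<^sub>F N in sequentially. inj (n N) \<and> range (n N) \<subseteq> {1..N}"
    using eventually_gt_at_top[of 0]
    by eventually_elim (use range_n in \<open>auto simp: inj_def image_subset_iff\<close>)
  moreover have "tendsto_mod_2pi (\<lambda>N. tooth_angle N (n N i)) (\<phi> $ i)" for i
    unfolding tendsto_mod_2pi_def
  proof (intro exI conjI allI)
    show "(\<lambda>N. tooth_angle N (n N i) + (\<phi> $ i - x i)) \<longlonglongrightarrow> \<phi> $ i"
      using tendsto_add[OF lim[of i] tendsto_const[of "\<phi> $ i - x i"]] by simp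
    show "[tooth_angle N (n N i) = tooth_angle N (n N i) + (\<phi> $ i - x i)] (rmod (2 * pi))" for N
      unfolding rcong_2pi_iff using x\<phi>[of i] by (intro exI[of _ "1 + \<lfloor>- \<phi> $ i / (2 * pi)\<rfloor>"]) simp
  qed
  ultimately show ?thesis unfolding teeth_tend_to_def by blast
qed

lemma p_S_eq:
  assumes comb: "random_comb M X" and \<phi>: "\<phi> \<in> S_set"
  shows "p_S M X \<phi> = support_density (vartheta \<phi>)"
  unfolding p_S_def
proof (rule the_equality)
  show lim: "has_support_limit M X \<phi> (support_density (vartheta \<phi>))"
    by (rule has_support_limit_density[OF comb \<phi>])
  fix p assume "has_support_limit M X \<phi> p"
  with lim teeth_tend_to_exists[OF \<phi>] show "p = support_density (vartheta \<phi>)"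
    unfolding has_support_limit_def by (blast intro: LIMSEQ_unique)
qed

lemma vartheta_surj:
  assumes "\<theta> \<in> T_set"
  shows "\<exists>\<phi>. \<phi> \<in> S_set \<and> vartheta \<phi> = \<theta>"
proof -
  let ?\<phi> = "vector [0, \<theta> $ 3, \<theta> $ 3 + \<theta> $ 1] :: real ^ 3"
  have \<theta>: "\<forall>i. \<theta> $ i > 0" "\<theta> $ 1 + \<theta> $ 2 + \<theta> $ 3 = 2 * pi"
    using assms by (auto simp: T_set_def sum_3)
  have "[?\<phi> $ 1 - ?\<phi> $ 3 = \<theta> $ 2] (rmod (2 * pi))"
    unfolding rcong_2pi_iff by (rule exI[of _ "-1"]) (use \<theta> in simp)
  then have "arc_gaps ?\<phi> \<theta>" using \<theta> by (simp add: arc_gaps_iff)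
  then have "vartheta ?\<phi> = \<theta>" by (rule vartheta_eq)
  then show ?thesis using \<open>arc_gaps ?\<phi> \<theta>\<close> assms by (metis S_set_iff)
qed

lemma p_T_eq:
  assumes comb: "random_comb M X" and \<theta>: "\<theta> \<in> T_set"
  shows "p_T M X \<theta> = 2 * pi * support_density \<theta>"
proof -
  have "(SOME \<phi>. \<phi> \<in> S_set \<and> vartheta \<phi> = \<theta>) \<in> S_set \<and> vartheta (SOME \<phi>. \<phi> \<in> S_set \<and> vartheta \<phi> = \<theta>) = \<theta>"
    by (rule someI_ex[OF vartheta_surj[OF \<theta>]])
  then show ?thesis unfolding p_T_def using p_S_eq[OF comb] by simp
qed

theorem theorem1p2:
  fixes M :: "nat \<Rightarrow> 'a measure" and X :: "nat \<Rightarrow> nat \<Rightarrow> 'a \<Rightarrow> real"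
  assumes "random_comb M X"
  shows "(\<forall>\<phi>\<in>S_set. has_support_limit M X \<phi> (p_S M X \<phi>)) \<and>
    (\<forall>\<phi>\<in>S_set. p_T M X (vartheta \<phi>) = 2 * pi * p_S M X \<phi>) \<and>
    (\<forall>\<theta>\<in>T_set. p_T M X \<theta> =
       2 * pi * sin (\<theta> $ 1 / 2) * sin (\<theta> $ 2 / 2) * sin (\<theta> $ 3 / 2) *
       (1 / pi ^ 2 + (\<Sum>i\<in>UNIV. f_arc (\<theta> $ i))))"
proof (intro conjI ballI)
  show "has_support_limit M X \<phi> (p_S M X \<phi>)" if "\<phi> \<in> S_set" for \<phi>
    unfolding p_S_eq[OF assms that] by (rule has_support_limit_density[OF assms that])
  show "p_T M X (vartheta \<phi>) = 2 * pi * p_S M X \<phi>" if "\<phi> \<in> S_set" for \<phi>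
    using that p_T_eq[OF assms] p_S_eq[OF assms that] by (simp add: S_set_iff)
  show "p_T M X \<theta> = 2 * pi * sin (\<theta> $ 1 / 2) * sin (\<theta> $ 2 / 2) * sin (\<theta> $ 3 / 2) *
       (1 / pi ^ 2 + (\<Sum>i\<in>UNIV. f_arc (\<theta> $ i)))" if "\<theta> \<in> T_set" for \<theta>
    unfolding p_T_eq[OF assms that] support_density_def by (simp add: mult.assoc)
qed

end
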